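(* Let $G$ be a finite simple graph on the vertex set $[d]=\{1,\ldots,d\}$ and let $\mathcal{B}_G\subset\mathbb{R}^d$ be the convex hull of $$B(G)=\{\mathbf{0},\pm\mathbf{e}_1,\ldots,\pm\mathbf{e}_d\}\cup\{\pm\mathbf{e}_i\pm\mathbf{e}_j : \{i,j\}\in E(G)\}.$$ Then the following conditions are equivalent: (i) $\mathcal{B}_G$ is reflexive and has a regular unimodular triangulation; (ii) $\mathcal{B}_G$ is reflexive; (iii) $G$ is a bipartite graph.
   Context: $\mathbf{e}_i$ denotes the $i$-th unit coordinate vector of $\mathbb{R}^d$ and $E(G)$ the edge set of $G$; all four sign choices in $\pm\mathbf{e}_i\pm\mathbf{e}_j$ are included. A $d$-dimensional lattice polytope $\mathcal{P}\subset\mathbb{R}^d$ is called reflexive if the origin is the unique lattice point in the interior of $\mathcal{P}$ and the dual polytope $\mathcal{P}^\vee=\{\mathbf{y}\in\mathbb{R}^d : \langle \mathbf{x},\mathbf{y}\rangle\le 1 \text{ for all } \mathbf{x}\in\mathcal{P}\}$ is also a lattice polytope. *)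

theory Defs
  imports "HOL-Analysis.Analysis"
begin

text \<open>
  Finite simple graphs on the vertex set \<open>[d]\<close>: the vertex set is a finite type of
  cardinality \<open>d\<close>, so that \<open>\<real>\<^sup>d\<close> is \<^typ>\<open>real ^ 'n\<close>, and a graph is given by its edge set.
\<close>

definition simple_graph :: "'n::finite set set \<Rightarrow> bool" where
  "simple_graph E \<longleftrightarrow> (\<forall>e\<in>E. card e = 2)"

definition bipartite :: "'n::finite set set \<Rightarrow> bool" where
  "bipartite E \<longleftrightarrow>
     (\<exists>X Y. X \<union> Y = UNIV \<and> X \<inter> Y = {} \<and> (\<forall>e\<in>E. \<exists>x\<in>X. \<exists>y\<in>Y. e = {x, y}))"

definition lattice_points :: "(real ^ 'n::finite) set" where
  "lattice_points = {x. \<forall>i. x $ i \<in> \<int>}"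

definition lattice_polytope :: "(real ^ 'n::finite) set \<Rightarrow> bool" where
  "lattice_polytope P \<longleftrightarrow> (\<exists>V. finite V \<and> V \<subseteq> lattice_points \<and> P = convex hull V)"

definition dual_polytope :: "(real ^ 'n::finite) set \<Rightarrow> (real ^ 'n) set" where
  "dual_polytope P = {y. \<forall>x\<in>P. x \<bullet> y \<le> 1}"

definition reflexive :: "(real ^ 'n::finite) set \<Rightarrow> bool" where
  "reflexive P \<longleftrightarrow>
     lattice_polytope P \<and> aff_dim P = int CARD('n) \<and>
     interior P \<inter> lattice_points = {0} \<and>
     lattice_polytope (dual_polytope P)"

definition lattice_triangulation_of ::
    "(real ^ 'n::finite) set set \<Rightarrow> (real ^ 'n) set \<Rightarrow> bool" where
  "lattice_triangulation_of T P \<longleftrightarrow>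
     simplicial_complex T \<and> \<Union>T = P \<and> (\<forall>S\<in>T. lattice_polytope S)"

text \<open>
  A lattice simplex is unimodular if its vertices form an affine basis of the lattice of
  integer points of its affine hull; in full dimension this says that its normalized
  volume is 1.
\<close>

definition unimodular_simplex :: "(real ^ 'n::finite) set \<Rightarrow> bool" where
  "unimodular_simplex S \<longleftrightarrow>
     (\<exists>C. C \<subseteq> lattice_points \<and> \<not> affine_dependent C \<and> S = convex hull C \<and>
        (\<forall>x \<in> affine hull C \<inter> lattice_points.
           \<exists>u :: real ^ 'n \<Rightarrow> int.
             (\<Sum>v\<in>C. u v) = 1 \<and> x = (\<Sum>v\<in>C. of_int (u v) *\<^sub>R v)))"

definition lifted_polytope ::
    "(real ^ 'n::finite) set \<Rightarrow> (real ^ 'n \<Rightarrow> real) \<Rightarrow> ((real ^ 'n) \<times> real) set" where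
  "lifted_polytope A \<omega> = convex hull ((\<lambda>a. (a, \<omega> a)) ` A)"

text \<open>
  Lower faces: those on which some linear functional whose last coordinate is positive
  (normalized to 1) attains its minimum.
\<close>

definition lower_faces :: "((real ^ 'n::finite) \<times> real) set \<Rightarrow> ((real ^ 'n) \<times> real) set set" where
  "lower_faces Q = {F. \<exists>c. F = {z\<in>Q. \<forall>w\<in>Q. (c, 1) \<bullet> z \<le> (c, 1) \<bullet> w}}"

text \<open>
  Lower faces of a nonempty polytope are nonempty, whereas a
  nonempty \<^const>\<open>simplicial_complex\<close> contains the empty face.
\<close>

definition regular_triangulation_of ::
    "(real ^ 'n::finite) set set \<Rightarrow> (real ^ 'n) set \<Rightarrow> bool" where
  "regular_triangulation_of T P \<longleftrightarrow>
     lattice_triangulation_of T P \<and>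
     (\<exists>\<omega>. T - {{}} = (\<lambda>F. fst ` F) ` lower_faces (lifted_polytope (P \<inter> lattice_points) \<omega>))"

definition has_regular_unimodular_triangulation :: "(real ^ 'n::finite) set \<Rightarrow> bool" where
  "has_regular_unimodular_triangulation P \<longleftrightarrow>
     (\<exists>T. regular_triangulation_of T P \<and> (\<forall>S\<in>T. unimodular_simplex S))"

definition B_set :: "'n::finite set set \<Rightarrow> (real ^ 'n) set" where
  "B_set E =
     {0} \<union> {s *\<^sub>R axis i 1 | s i. s \<in> {1, -1}} \<union>
     {s *\<^sub>R axis i 1 + t *\<^sub>R axis j 1 | s t i j. s \<in> {1, -1} \<and> t \<in> {1, -1} \<and> {i, j} \<in> E}"

definition B_polytope :: "'n::finite set set \<Rightarrow> (real ^ 'n) set" where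
  "B_polytope E = convex hull (B_set E)"

end

theory Submission
  imports Defs "HOL-Library.Nat_Bijection"
begin

text \<open>
  The dual of the polytope is cut out by \<open>\<bar>y\<^sub>i\<bar> \<le> 1\<close> and
  \<open>\<bar>y\<^sub>i\<bar> + \<bar>y\<^sub>j\<bar> \<le> 1\<close> for edges \<open>{i, j}\<close>. If it is a lattice polytope, the lattice
  points used to represent \<open>(1/2, \<dots>, 1/2)\<close> are 2-colourings of the graph; conversely, for a
  bipartite graph a fractional point of the dual can be moved in two opposite directions and
  is therefore not a vertex.

  For a bipartite graph the lattice points are exactly \<open>B(G)\<close>. Give \<open>0\<close> the weight 0 and
  \<open>v \<noteq> 0\<close> the weight \<open>K (1 + \<parallel>v\<parallel>\<^sub>1)\<close> plus a small generic perturbation with distinct subset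
  sums. The dominant part forces every lower cell into a single orthant. There a linearly
  independent set of vectors always has a coordinate met by just one of them, which makes it
  unimodular; hence a minimal linear relation has coefficients \<open>\<plusminus>1\<close>, and the weights exclude such
  a relation inside a lower cell. So each cell is a unimodular simplex.
\<close>

section \<open>Lower cells of a weighted point configuration\<close>

text \<open>The nonnegative terms \<open>u a * (g a - m)\<close> have sum at most 0, so each of them
  vanishes. This complementary slackness argument is used wherever the support of a convex
  combination has to be located on a face.\<close>

lemma convex_combination_tight:
  fixes u g :: "'a \<Rightarrow> real"
  assumes "finite A" and u: "\<And>a. a \<in> A \<Longrightarrow> 0 \<le> u a" "sum u A = 1"
    and g: "\<And>a. a \<in> A \<Longrightarrow> m \<le> g a" and le: "(\<Sum>a\<in>A. u a * g a) \<le> m"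
    and a: "a \<in> A" "u a \<noteq> 0"
  shows "g a = m"
proof -
  have "(\<Sum>a\<in>A. u a * (g a - m)) = (\<Sum>a\<in>A. u a * g a) - m"
    using u(2) by (simp add: right_diff_distrib sum_subtractf flip: sum_distrib_right)
  moreover have "0 \<le> (\<Sum>a\<in>A. u a * (g a - m))"
    by (intro sum_nonneg mult_nonneg_nonneg) (use u g in auto)
  ultimately have "(\<Sum>a\<in>A. u a * (g a - m)) = 0"
    using le by linarith
  then have "u a * (g a - m) = 0"
    using sum_nonneg_eq_0_iff[of A "\<lambda>a. u a * (g a - m)"] u g a \<open>finite A\<close> by auto
  then show ?thesis
    using a by simp
qed

lemma convex_combination_in_hull_support:
  fixes u :: "'a::real_vector \<Rightarrow> real"
  assumes "finite A" "\<And>a. a \<in> A \<Longrightarrow> 0 \<le> u a" "sum u A = 1"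
    and "C \<subseteq> A" "\<And>a. a \<in> A \<Longrightarrow> u a \<noteq> 0 \<Longrightarrow> a \<in> C"
  shows "(\<Sum>a\<in>A. u a *\<^sub>R a) \<in> convex hull C"
proof -
  have "finite C" using assms finite_subset by blast
  have "sum u C = sum u A" "(\<Sum>a\<in>C. u a *\<^sub>R a) = (\<Sum>a\<in>A. u a *\<^sub>R a)"
    using assms by (intro sum.mono_neutral_left; auto)+
  then show ?thesis
    unfolding convex_hull_finite[OF \<open>finite C\<close>] using assms by auto
qed

section \<open>Lifted polytopes and the vertex sets of their lower faces\<close>

lemma lifted_polytope_finite:
  assumes "finite A"
  shows "lifted_polytope A \<omega> =
    {z. \<exists>u. (\<forall>a\<in>A. 0 \<le> u a) \<and> sum u A = 1 \<and> z = (\<Sum>a\<in>A. u a *\<^sub>R a, \<Sum>a\<in>A. u a * \<omega> a)}"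
proof -
  let ?f = "\<lambda>a. (a, \<omega> a)"
  have inj: "inj_on ?f A" by (auto simp: inj_on_def)
  have pair: "(\<Sum>a\<in>A. u a *\<^sub>R ?f a) = (\<Sum>a\<in>A. u a *\<^sub>R a, \<Sum>a\<in>A. u a * \<omega> a)" for u
    by (simp add: prod_eq_iff fst_sum snd_sum)
  have "(\<exists>u. (\<forall>z\<in>?f ` A. 0 \<le> u z) \<and> sum u (?f ` A) = 1 \<and> (\<Sum>z\<in>?f ` A. u z *\<^sub>R z) = z) \<longleftrightarrow>
        (\<exists>u. (\<forall>a\<in>A. 0 \<le> u a) \<and> sum u A = 1 \<and> z = (\<Sum>a\<in>A. u a *\<^sub>R a, \<Sum>a\<in>A. u a * \<omega> a))"
    (is "?l \<longleftrightarrow> ?r") for z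
  proof
    assume ?l
    then obtain u where "\<forall>z\<in>?f ` A. 0 \<le> u z" "sum u (?f ` A) = 1" "(\<Sum>z\<in>?f ` A. u z *\<^sub>R z) = z"
      by blast
    then show ?r
      by (intro exI[of _ "u \<circ> ?f"]) (simp add: sum.reindex[OF inj] flip: pair)
  next
    assume ?r
    then obtain u where u: "\<forall>a\<in>A. 0 \<le> u a" "sum u A = 1" "z = (\<Sum>a\<in>A. u a *\<^sub>R ?f a)"
      unfolding pair by blast
    then show ?l
      by (intro exI[of _ "u \<circ> fst"]) (simp add: sum.reindex[OF inj])
  qed
  then show ?thesis
    unfolding lifted_polytope_def convex_hull_finite[OF finite_imageI[OF assms]] by blast
qed

lemma lifted_polytopeE:
  assumes "finite A" "z \<in> lifted_polytope A \<omega>"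
  obtains u where "\<forall>a\<in>A. 0 \<le> u a" "sum u A = 1"
    "z = (\<Sum>a\<in>A. u a *\<^sub>R a, \<Sum>a\<in>A. u a * \<omega> a)"
  using assms(2) unfolding lifted_polytope_finite[OF assms(1)] by (elim CollectE exE conjE)

text \<open>The points of the configuration whose lifts minimize the functional
  \<open>(c, 1)\<close>. Working with these finite sets instead of the projected faces makes faces
  and intersections combinatorial.\<close>

definition lower_cell ::
    "(real ^ 'n::finite) set \<Rightarrow> (real ^ 'n \<Rightarrow> real) \<Rightarrow> real ^ 'n \<Rightarrow> (real ^ 'n) set" where
  "lower_cell A \<omega> c = {a\<in>A. \<forall>b\<in>A. c \<bullet> a + \<omega> a \<le> c \<bullet> b + \<omega> b}"

lemma lower_cell_subset: "lower_cell A \<omega> c \<subseteq> A"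
  by (auto simp: lower_cell_def)

lemma lower_cell_witness:
  assumes "finite A" "A \<noteq> {}"
  obtains a where "a \<in> lower_cell A \<omega> c"
proof -
  obtain a where "a \<in> A" "\<And>b. b \<in> A \<Longrightarrow> c \<bullet> a + \<omega> a \<le> c \<bullet> b + \<omega> b"
    using ex_is_arg_min_if_finite[OF assms, of "\<lambda>a. c \<bullet> a + \<omega> a"]
    by (auto simp: is_arg_min_linorder)
  then show thesis
    by (intro that) (auto simp: lower_cell_def)
qed

lemma lower_cell_eq:
  assumes "a \<in> lower_cell A \<omega> c"
  shows "lower_cell A \<omega> c = {b\<in>A. c \<bullet> b + \<omega> b = c \<bullet> a + \<omega> a}"
  using assms unfolding lower_cell_def by (auto intro: antisym)

lemma lower_cell_le:
  assumes "a \<in> lower_cell A \<omega> c" "b \<in> A"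
  shows "c \<bullet> a + \<omega> a \<le> c \<bullet> b + \<omega> b"
  using assms unfolding lower_cell_def by blast

lemma inner_lift_combination:
  fixes u :: "real ^ 'n \<Rightarrow> real"
  shows "(c, 1) \<bullet> (\<Sum>a\<in>A. u a *\<^sub>R a, \<Sum>a\<in>A. u a * \<omega> a) = (\<Sum>a\<in>A. u a * (c \<bullet> a + \<omega> a))"
  by (simp add: inner_sum_right sum.distrib algebra_simps)

text \<open>A linear functional attains its minimum over the lifted hull at a lifted generator, and
  by tightness a minimizing combination puts weight only on points of the cell. This links the
  definition of lower faces to \<open>lower_cell\<close>.\<close>

lemma fst_lower_face:
  assumes "finite A" "A \<noteq> {}"
  shows "fst ` {z \<in> lifted_polytope A \<omega>. \<forall>w\<in>lifted_polytope A \<omega>. (c, 1) \<bullet> z \<le> (c, 1) \<bullet> w} =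
         convex hull (lower_cell A \<omega> c)" (is "fst ` ?F = _")
proof -
  let ?Q = "lifted_polytope A \<omega>"
  let ?C = "lower_cell A \<omega> c"
  obtain a0 where a0: "a0 \<in> ?C" using lower_cell_witness[OF assms] .
  define m where "m = c \<bullet> a0 + \<omega> a0"
  have ge: "m \<le> c \<bullet> a + \<omega> a" if "a \<in> A" for a
    using lower_cell_le[OF a0 that] by (simp add: m_def)
  have C: "?C = {a\<in>A. c \<bullet> a + \<omega> a = m}"
    using lower_cell_eq[OF a0] by (simp add: m_def)
  have lower: "m \<le> (c, 1) \<bullet> w" if wQ: "w \<in> ?Q" for w
  proof -
    obtain u where u: "\<forall>a\<in>A. 0 \<le> u a" "sum u A = 1"
      and w: "w = (\<Sum>a\<in>A. u a *\<^sub>R a, \<Sum>a\<in>A. u a * \<omega> a)"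
      using lifted_polytopeE[OF assms(1) wQ] .
    have "m = (\<Sum>a\<in>A. u a * m)" using u by (simp flip: sum_distrib_right)
    also have "\<dots> \<le> (\<Sum>a\<in>A. u a * (c \<bullet> a + \<omega> a))"
      by (intro sum_mono mult_left_mono) (use u ge in auto)
    finally show ?thesis unfolding w inner_lift_combination .
  qed
  have a0Q: "(a0, \<omega> a0) \<in> ?Q"
    unfolding lifted_polytope_def using a0 lower_cell_subset[of A \<omega> c] by (intro hull_inc) auto
  show ?thesis
  proof (intro equalityI subsetI)
    fix x assume "x \<in> fst ` ?F"
    then obtain z where z: "z \<in> ?Q" "(c, 1) \<bullet> z \<le> m" "x = fst z"
      using a0Q by (force simp: m_def)
    obtain u where u: "\<forall>a\<in>A. 0 \<le> u a" "sum u A = 1"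
      and zu: "z = (\<Sum>a\<in>A. u a *\<^sub>R a, \<Sum>a\<in>A. u a * \<omega> a)"
      using lifted_polytopeE[OF assms(1) z(1)] .
    have "(\<Sum>a\<in>A. u a *\<^sub>R a) \<in> convex hull ?C"
    proof (rule convex_combination_in_hull_support)
      fix a assume "a \<in> A" "u a \<noteq> 0"
      then have "c \<bullet> a + \<omega> a = m"
        using convex_combination_tight[of A u m "\<lambda>a. c \<bullet> a + \<omega> a" a] assms u ge z(2)
        unfolding zu inner_lift_combination by blast
      then show "a \<in> ?C" using \<open>a \<in> A\<close> C by simp
    qed (use assms u lower_cell_subset[of A \<omega> c] in auto)
    then show "x \<in> convex hull ?C" using z zu by simp
  next
    fix x assume "x \<in> convex hull ?C"
    have "finite ?C" using assms(1) lower_cell_subset by (rule rev_finite_subset)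
    obtain u where u: "\<forall>a\<in>?C. 0 \<le> u a" "sum u ?C = 1" and x: "x = (\<Sum>a\<in>?C. u a *\<^sub>R a)"
      using \<open>x \<in> convex hull ?C\<close> unfolding convex_hull_finite[OF \<open>finite ?C\<close>] by blast
    define z where "z = (\<Sum>a\<in>?C. u a *\<^sub>R a, \<Sum>a\<in>?C. u a * \<omega> a)"
    have "z \<in> lifted_polytope ?C \<omega>"
      unfolding z_def lifted_polytope_finite[OF \<open>finite ?C\<close>] using u by blast
    then have "z \<in> ?Q"
      using hull_mono[of "(\<lambda>a. (a, \<omega> a)) ` ?C" "(\<lambda>a. (a, \<omega> a)) ` A" convex]
      unfolding lifted_polytope_def using lower_cell_subset by blast
    moreover have "(c, 1) \<bullet> z = m"
    proof -
      have "(c, 1) \<bullet> z = (\<Sum>a\<in>?C. u a * m)"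
        unfolding z_def inner_lift_combination by (intro sum.cong) (auto simp: C)
      then show ?thesis using u by (simp flip: sum_distrib_right)
    qed
    ultimately show "x \<in> fst ` ?F"
      using lower x z_def by (intro image_eqI[of _ _ z]) auto
  qed
qed

section \<open>The lower cells cover the polytope\<close>

text \<open>A hyperplane supports the lifted polytope at its lowest point over \<open>x\<close>.
  Since \<open>x\<close> is interior, that hyperplane is not vertical, so its normal can be scaled
  to the form \<open>(c, 1)\<close>.\<close>

lemma lower_cells_cover_interior:
  assumes "finite A" "x \<in> interior (convex hull A)"
  obtains c where "x \<in> convex hull (lower_cell A \<omega> c)"
proof -
  let ?Q = "lifted_polytope A \<omega>"
  have "A \<noteq> {}" using assms by auto
  have Q: "compact ?Q" "convex ?Q"
    unfolding lifted_polytope_def using assms by (auto intro: finite_imp_compact_convex_hull)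
  have fstQ: "\<exists>r. (y, r) \<in> ?Q" if y: "y \<in> convex hull A" for y
    using y unfolding lifted_polytope_finite[OF assms(1)] convex_hull_finite[OF assms(1)] by blast
  \<comment> \<open>The heights of the lifted polytope over \<open>x\<close> form a nonempty compact
    set, so a lowest one exists.\<close>
  define I where "I = snd ` (?Q \<inter> ({x} \<times> UNIV))"
  have "compact I"
    unfolding I_def by (intro compact_continuous_image continuous_intros compact_Int_closed Q)
      (auto intro: closed_Times)
  moreover have "I \<noteq> {}"
    using fstQ[of x] assms interior_subset unfolding I_def by fastforce
  ultimately obtain t0 where t0: "t0 \<in> I" "\<And>t. t \<in> I \<Longrightarrow> t0 \<le> t"
    using compact_attains_inf[of I] by blast
  have xt0: "(x, t0) \<in> ?Q" using t0(1) by (auto simp: I_def)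
  have min: "t0 \<le> t" if "(x, t) \<in> ?Q" for t
    using t0(2) that by (force simp: I_def)
  \<comment> \<open>The open vertical ray below the lowest lift of \<open>x\<close> is convex and
    misses the lifted polytope.\<close>
  have "\<exists>a b. a \<noteq> 0 \<and> (\<forall>z\<in>{x} \<times> {..<t0}. a \<bullet> z \<le> b) \<and> (\<forall>z\<in>?Q. b \<le> a \<bullet> z)"
    by (rule separating_hyperplane_sets)
       (use Q xt0 min in \<open>auto intro: convex_Times simp: lessThan_empty_iff, fastforce\<close>)
  then obtain p s b where ps: "(p, s) \<noteq> 0"
    and below: "\<And>t. t < t0 \<Longrightarrow> p \<bullet> x + s * t \<le> b"
    and above: "\<And>y r. (y, r) \<in> ?Q \<Longrightarrow> b \<le> p \<bullet> y + s * r"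
    by fastforce
  have "0 \<le> s"
    using below[of "t0 - 1"] above[OF xt0] by (simp add: algebra_simps)
  have b: "b = p \<bullet> x + s * t0"
  proof (rule antisym)
    show "b \<le> p \<bullet> x + s * t0" using above[OF xt0] .
    have "s * (t0 - t) \<ge> p \<bullet> x + s * t0 - b" if "t < t0" for t
      using below[OF that] by (simp add: algebra_simps)
    then have *: "p \<bullet> x + s * t0 - b \<le> s * e" if "e > 0" for e
      using that by (metis add.commute add_diff_cancel diff_gt_0_iff_gt diff_diff_eq2)
    show "p \<bullet> x + s * t0 \<le> b"
    proof (rule ccontr)
      assume "\<not> ?thesis"
      then have d: "0 < p \<bullet> x + s * t0 - b" (is "0 < ?d") by simp
      \<comment> \<open>The denominator contains \<open>s + 1\<close> because \<open>s = 0\<close>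
        is not excluded yet; the resulting bound is strictly below \<open>?d\<close>.\<close>
      have "?d \<le> s * (?d / (2 * (s + 1)))"
        by (rule *) (use d \<open>0 \<le> s\<close> in simp)
      also have "\<dots> = ?d * (s / (2 * (s + 1)))" by simp
      also have "\<dots> < ?d * 1"
        using \<open>0 \<le> s\<close> by (intro mult_strict_left_mono d) simp
      finally show False by simp
    qed
  qed
  have "s \<noteq> 0"
  proof
    assume "s = 0"
    then have "p \<noteq> 0" using ps by (simp add: zero_prod_def)
    obtain e where e: "0 < e" "ball x e \<subseteq> convex hull A"
      using assms(2) mem_interior by blast
    \<comment> \<open>Moving against \<open>p\<close> by half the radius of the ball stays in the
      hull and lowers the value of \<open>p\<close>, although with \<open>s = 0\<close> the
      separation makes that value minimal at \<open>x\<close>.\<close>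
    define y where "y = x - (e / (2 * norm p)) *\<^sub>R p"
    have "y \<in> convex hull A"
      using e \<open>p \<noteq> 0\<close> by (intro subsetD[OF e(2)]) (simp add: y_def dist_norm)
    then obtain r where "(y, r) \<in> ?Q" using fstQ by blast
    then have "p \<bullet> x \<le> p \<bullet> y" using above b \<open>s = 0\<close> by fastforce
    then have "e / (2 * norm p) * (p \<bullet> p) \<le> 0"
      by (simp add: y_def inner_diff_right)
    moreover have "0 < e / (2 * norm p) * (p \<bullet> p)"
      using e \<open>p \<noteq> 0\<close> by simp
    ultimately show False by linarith
  qed
  with \<open>0 \<le> s\<close> have "0 < s" by simp
  have "x \<in> fst ` {z \<in> ?Q. \<forall>w\<in>?Q. (p /\<^sub>R s, 1) \<bullet> z \<le> (p /\<^sub>R s, 1) \<bullet> w}"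
  proof (rule image_eqI[of _ _ "(x, t0)"])
    have "p \<bullet> x / s + t0 \<le> p \<bullet> y / s + r" if "(y, r) \<in> ?Q" for y r
    proof -
      have "(p \<bullet> x + s * t0) / s \<le> (p \<bullet> y + s * r) / s"
        using above[OF that] b \<open>0 < s\<close> by (intro divide_right_mono) auto
      then show ?thesis using \<open>0 < s\<close> by (simp add: add_divide_distrib)
    qed
    then show "(x, t0) \<in> {z \<in> ?Q. \<forall>w\<in>?Q. (p /\<^sub>R s, 1) \<bullet> z \<le> (p /\<^sub>R s, 1) \<bullet> w}"
      using xt0 by (auto simp: divide_inverse mult.commute)
  qed simp
  then show thesis
    using that fst_lower_face[OF assms(1) \<open>A \<noteq> {}\<close>] by blast
qed

lemma finite_lower_cells:
  assumes "finite A"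
  shows "finite (range (lower_cell A \<omega>))"
  by (rule finite_subset[of _ "Pow A"]) (simp_all add: assms image_subset_iff lower_cell_subset)

text \<open>A finite union of compact hulls is closed and contains the interior, whose closure is
  the whole polytope. Boundary points, where a supporting hyperplane of the lift may be vertical,
  are thus reached by closure.\<close>

lemma lower_cells_cover:
  assumes "finite A" "interior (convex hull A) \<noteq> {}"
  shows "(\<Union>c. convex hull (lower_cell A \<omega> c)) = convex hull A" (is "?U = ?P")
proof
  show "?U \<subseteq> ?P"
    by (intro UN_least hull_mono lower_cell_subset)
  have "closed (\<Union>C\<in>range (lower_cell A \<omega>). convex hull C)"
  proof (rule closed_UN[OF finite_lower_cells[OF assms(1)] ballI])
    fix C assume "C \<in> range (lower_cell A \<omega>)"
    then have "finite C"
      using assms(1) lower_cell_subset finite_subset by (metis imageE)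
    then show "closed (convex hull C)"
      by (intro compact_imp_closed finite_imp_compact_convex_hull)
  qed
  then have "closed ?U" by simp
  moreover have "interior ?P \<subseteq> ?U"
  proof
    fix x assume "x \<in> interior ?P"
    then obtain c where "x \<in> convex hull (lower_cell A \<omega> c)"
      using lower_cells_cover_interior[OF assms(1)] by metis
    then show "x \<in> ?U" by blast
  qed
  ultimately have "closure (interior ?P) \<subseteq> ?U" by (rule closure_minimal[rotated])
  then show "?P \<subseteq> ?U"
    using convex_closure_interior[OF convex_convex_hull assms(2)] closure_subset[of ?P] by simp
qed

section \<open>Intersections and faces of lower cells\<close>

text \<open>Represent a common point by weights \<open>u\<close> on the first cell and
  \<open>v\<close> on the second. The \<open>u\<close>-lift is no higher than the
  \<open>v\<close>-lift, so it also attains the minimum of the \<open>d\<close>-functional, and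
  tightness places the support of \<open>u\<close> in both cells.\<close>

lemma lower_cells_Int_hull:
  assumes "finite A"
  shows "convex hull (lower_cell A \<omega> c) \<inter> convex hull (lower_cell A \<omega> d) =
         convex hull (lower_cell A \<omega> c \<inter> lower_cell A \<omega> d)"
proof (cases "A = {}")
  case True
  then show ?thesis by (simp add: lower_cell_def)
next
  case False
  let ?C = "lower_cell A \<omega> c" and ?D = "lower_cell A \<omega> d"
  have fin: "finite ?C" "finite ?D"
    using rev_finite_subset[OF assms lower_cell_subset] by blast+
  have "x \<in> convex hull (?C \<inter> ?D)" if xC: "x \<in> convex hull ?C" and xD: "x \<in> convex hull ?D" for x
  proof -
    obtain u where u: "\<forall>a\<in>?C. 0 \<le> u a" "sum u ?C = 1" "(\<Sum>a\<in>?C. u a *\<^sub>R a) = x"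
      using xC unfolding convex_hull_finite[OF fin(1)] by blast
    obtain v where v: "\<forall>a\<in>?D. 0 \<le> v a" "sum v ?D = 1" "(\<Sum>a\<in>?D. v a *\<^sub>R a) = x"
      using xD unfolding convex_hull_finite[OF fin(2)] by blast
    obtain a0 where a0: "a0 \<in> ?C" using lower_cell_witness[OF assms False] .
    obtain b0 where b0: "b0 \<in> ?D" using lower_cell_witness[OF assms False] .
    have val: "(\<Sum>a\<in>S. w a * (p \<bullet> a + \<omega> a)) = p \<bullet> x + (\<Sum>a\<in>S. w a * \<omega> a)"
      if "(\<Sum>a\<in>S. w a *\<^sub>R a) = x" for S w p
      using inner_lift_combination[of p w S \<omega>] that by simp
    have const: "(\<Sum>a\<in>S. w a * (p \<bullet> a + \<omega> a)) = k"
      if "sum w S = 1" "\<And>a. a \<in> S \<Longrightarrow> p \<bullet> a + \<omega> a = k" for S w p k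
    proof -
      have "(\<Sum>a\<in>S. w a * (p \<bullet> a + \<omega> a)) = (\<Sum>a\<in>S. w a * k)" using that by simp
      then show ?thesis using that by (simp flip: sum_distrib_right)
    qed
    have cx: "c \<bullet> x + (\<Sum>a\<in>?C. u a * \<omega> a) = c \<bullet> a0 + \<omega> a0"
      using const[OF u(2), of c "c \<bullet> a0 + \<omega> a0"] val[OF u(3), of c] lower_cell_eq[OF a0]
      by auto
    have dx: "d \<bullet> x + (\<Sum>a\<in>?D. v a * \<omega> a) = d \<bullet> b0 + \<omega> b0"
      using const[OF v(2), of d "d \<bullet> b0 + \<omega> b0"] val[OF v(3), of d] lower_cell_eq[OF b0]
      by auto
    \<comment> \<open>Minimality of the \<open>c\<close>-value, averaged with the weights
      \<open>v\<close>, compares the heights of the two lifts of \<open>x\<close>.\<close>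
    have "c \<bullet> a0 + \<omega> a0 = (\<Sum>a\<in>?D. v a * (c \<bullet> a0 + \<omega> a0))"
      using v(2) by (simp flip: sum_distrib_right)
    also have "\<dots> \<le> (\<Sum>a\<in>?D. v a * (c \<bullet> a + \<omega> a))"
      by (intro sum_mono mult_left_mono) (use v a0 in \<open>auto simp: lower_cell_def\<close>)
    finally have "(\<Sum>a\<in>?C. u a * \<omega> a) \<le> (\<Sum>a\<in>?D. v a * \<omega> a)"
      using cx val[OF v(3), of c] by linarith
    then have le: "(\<Sum>a\<in>?C. u a * (d \<bullet> a + \<omega> a)) \<le> d \<bullet> b0 + \<omega> b0"
      using dx val[OF u(3), of d] by linarith
    have "(\<Sum>a\<in>?C. u a *\<^sub>R a) \<in> convex hull (?C \<inter> ?D)"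
    proof (rule convex_combination_in_hull_support)
      fix a assume a: "a \<in> ?C" "u a \<noteq> 0"
      have "d \<bullet> a + \<omega> a = d \<bullet> b0 + \<omega> b0"
        by (rule convex_combination_tight[OF fin(1) _ u(2) _ le a])
           (use u b0 in \<open>auto simp: lower_cell_def\<close>)
      then show "a \<in> ?C \<inter> ?D" using a b0 by (auto simp: lower_cell_def)
    qed (use u fin in auto)
    then show ?thesis using u(3) by simp
  qed
  moreover have "convex hull (?C \<inter> ?D) \<subseteq> convex hull ?C \<inter> convex hull ?D"
    by (simp add: hull_mono)
  ultimately show ?thesis by blast
qed

text \<open>Faces of a polytope are exposed, say by \<open>p\<close>. Tilting \<open>c\<close> to
  \<open>c - e *\<^sub>R p\<close> with small \<open>e > 0\<close> selects, among the minimizers for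
  \<open>c\<close>, exactly those that maximize \<open>p\<close>.\<close>

lemma lower_cell_face:
  assumes "finite A" "F face_of convex hull (lower_cell A \<omega> c)" "F \<noteq> {}"
  obtains d where "F = convex hull (lower_cell A \<omega> d)"
proof -
  let ?C = "lower_cell A \<omega> c"
  have fin: "finite ?C" using assms(1) lower_cell_subset by (rule rev_finite_subset)
  have "F exposed_face_of convex hull ?C"
    using exposed_face_of_polyhedron[OF polyhedron_convex_hull[OF fin]] assms by simp
  then obtain p b where pb: "convex hull ?C \<subseteq> {x. p \<bullet> x \<le> b}"
    and F: "F = convex hull ?C \<inter> {x. p \<bullet> x = b}"
    unfolding exposed_face_of_def by blast
  have pC: "p \<bullet> a \<le> b" if "a \<in> ?C" for a
    using pb that hull_inc by fastforce
  have hullF: "F = convex hull {a\<in>?C. p \<bullet> a = b}"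
  proof (intro equalityI subsetI)
    fix x assume "x \<in> F"
    then obtain u where u: "\<forall>a\<in>?C. 0 \<le> u a" "sum u ?C = 1" "(\<Sum>a\<in>?C. u a *\<^sub>R a) = x"
      and x: "p \<bullet> x = b"
      unfolding F convex_hull_finite[OF fin] by blast
    have le: "(\<Sum>a\<in>?C. u a * (- (p \<bullet> a))) \<le> - b"
      using x u(3) by (auto simp: inner_sum_right sum_negf)
    have "(\<Sum>a\<in>?C. u a *\<^sub>R a) \<in> convex hull {a\<in>?C. p \<bullet> a = b}"
    proof (rule convex_combination_in_hull_support)
      fix a assume a: "a \<in> ?C" "u a \<noteq> 0"
      have "- (p \<bullet> a) = - b"
        by (rule convex_combination_tight[OF fin _ u(2) _ le a]) (use u pC in auto)
      then show "a \<in> {a\<in>?C. p \<bullet> a = b}" using a by simp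
    qed (use u fin in auto)
    then show "x \<in> convex hull {a\<in>?C. p \<bullet> a = b}" using u by simp
  next
    fix x assume "x \<in> convex hull {a\<in>?C. p \<bullet> a = b}"
    moreover have "convex hull {a\<in>?C. p \<bullet> a = b} \<subseteq> convex hull ?C"
      by (intro hull_mono) auto
    moreover have "convex hull {a\<in>?C. p \<bullet> a = b} \<subseteq> {x. p \<bullet> x = b}"
      by (intro hull_minimal convex_hyperplane) auto
    ultimately show "x \<in> F" unfolding F by blast
  qed
  then have "{a\<in>?C. p \<bullet> a = b} \<noteq> {}" using \<open>F \<noteq> {}\<close> by (metis convex_hull_eq_empty)
  then obtain a1 where a1: "a1 \<in> ?C" "p \<bullet> a1 = b" by blast
  define m where "m = c \<bullet> a1 + \<omega> a1"
  have C: "?C = {a\<in>A. c \<bullet> a + \<omega> a = m}" and ge: "\<And>a. a \<in> A \<Longrightarrow> m \<le> c \<bullet> a + \<omega> a"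
    unfolding m_def using lower_cell_eq[OF a1(1)] lower_cell_le[OF a1(1)] by blast+
  \<comment> \<open>The finitely many points outside the cell have positive slack, so a small enough
    tilt makes none of them a minimizer.\<close>
  have "\<exists>e>0. \<forall>a\<in>A - ?C. e * (p \<bullet> a - b) < c \<bullet> a + \<omega> a - m"
  proof -
    have "\<forall>\<^sub>F e in at_right 0. \<forall>a\<in>A - ?C. e * (p \<bullet> a - b) < c \<bullet> a + \<omega> a - m"
    proof (rule eventually_ball_finite)
      show "finite (A - ?C)" using assms by simp
      show "\<forall>a\<in>A - ?C. \<forall>\<^sub>F e in at_right 0. e * (p \<bullet> a - b) < c \<bullet> a + \<omega> a - m"
      proof
        fix a assume "a \<in> A - ?C"
        then have "0 < c \<bullet> a + \<omega> a - m" using C ge[of a] by fastforce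
        moreover have "((\<lambda>e. e * (p \<bullet> a - b)) \<longlongrightarrow> 0 * (p \<bullet> a - b)) (at_right 0)"
          by (intro tendsto_intros)
        ultimately show "\<forall>\<^sub>F e in at_right 0. e * (p \<bullet> a - b) < c \<bullet> a + \<omega> a - m"
          by (intro order_tendstoD(2)[where y = "0 * (p \<bullet> a - b)"]) auto
      qed
    qed
    then have "\<forall>\<^sub>F e in at_right (0::real). 0 < e \<and> (\<forall>a\<in>A - ?C. e * (p \<bullet> a - b) < c \<bullet> a + \<omega> a - m)"
      using eventually_at_right_less[of "0::real"] by eventually_elim blast
    then show ?thesis
      using eventually_happens'[OF trivial_limit_at_right_real] by blast
  qed
  then obtain e where e: "0 < e" "\<And>a. a \<in> A \<Longrightarrow> a \<notin> ?C \<Longrightarrow> e * (p \<bullet> a - b) < c \<bullet> a + \<omega> a - m"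
    by blast
  define d where "d = c - e *\<^sub>R p"
  have dval: "d \<bullet> a + \<omega> a = c \<bullet> a + \<omega> a - e * (p \<bullet> a)" for a
    by (simp add: d_def inner_diff_left)
  have dge: "m - e * b \<le> d \<bullet> a + \<omega> a" and
    deq: "d \<bullet> a + \<omega> a = m - e * b \<longleftrightarrow> a \<in> ?C \<and> p \<bullet> a = b" if "a \<in> A" for a
  proof -
    consider "a \<in> ?C" | "a \<notin> ?C" by blast
    then have "m - e * b \<le> d \<bullet> a + \<omega> a \<and>
        (d \<bullet> a + \<omega> a = m - e * b \<longleftrightarrow> a \<in> ?C \<and> p \<bullet> a = b)"
    proof cases
      case 1
      then have "c \<bullet> a + \<omega> a = m" using C by simp
      moreover have "e * (p \<bullet> a) \<le> e * b" using pC[OF 1] e by simp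
      ultimately show ?thesis using 1 e unfolding dval by auto
    next
      case 2
      then show ?thesis using e(2)[OF that 2] unfolding dval by (simp add: algebra_simps)
    qed
    then show "m - e * b \<le> d \<bullet> a + \<omega> a" 
      "d \<bullet> a + \<omega> a = m - e * b \<longleftrightarrow> a \<in> ?C \<and> p \<bullet> a = b" by auto
  qed
  have a1A: "a1 \<in> A" using a1 lower_cell_subset by blast
  have a1d: "d \<bullet> a1 + \<omega> a1 = m - e * b" using deq[OF a1A] a1 by simp
  have "lower_cell A \<omega> d = {a\<in>A. d \<bullet> a + \<omega> a = m - e * b}"
  proof (intro equalityI subsetI)
    fix a assume "a \<in> lower_cell A \<omega> d"
    then have "a \<in> A" "d \<bullet> a + \<omega> a \<le> d \<bullet> a1 + \<omega> a1"
      using a1A unfolding lower_cell_def by blast+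
    then show "a \<in> {a\<in>A. d \<bullet> a + \<omega> a = m - e * b}"
      using dge[of a] a1d by simp
  next
    fix a assume "a \<in> {a\<in>A. d \<bullet> a + \<omega> a = m - e * b}"
    then show "a \<in> lower_cell A \<omega> d"
      using dge by (simp add: lower_cell_def)
  qed
  also have "\<dots> = {a\<in>?C. p \<bullet> a = b}"
    using deq lower_cell_subset[of A \<omega> c] by blast
  finally have "F = convex hull (lower_cell A \<omega> d)" using hullF by (simp only:)
  then show thesis by (rule that)
qed

section \<open>From lower cells to a regular unimodular triangulation\<close>

text \<open>Nonempty faces of cells are again cells, and two cells meet in the hull of their common
  points. Affine independence makes the hulls simplices and turns the hull of a subset of vertices
  into a face.\<close>

lemma lower_cells_simplicial_complex:
  assumes "finite A" and indep: "\<And>c. \<not> affine_dependent (lower_cell A \<omega> c)"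
  shows "simplicial_complex (insert {} (range (\<lambda>c. convex hull (lower_cell A \<omega> c))))"
    (is "simplicial_complex ?T")
  unfolding simplicial_complex_def
proof (intro conjI ballI allI impI)
  have "range (\<lambda>c. convex hull (lower_cell A \<omega> c)) = (hull) convex ` range (lower_cell A \<omega>)"
    by auto
  then show "finite ?T" using finite_lower_cells[OF assms(1), of \<omega>] by simp
next
  fix S assume "S \<in> ?T"
  then consider "S = {}" | c where "S = convex hull (lower_cell A \<omega> c)" by auto
  then show "\<exists>n. n simplex S"
  proof cases
    case 1 then show ?thesis by auto
  next
    case 2
    then show ?thesis using indep
      by (intro exI[of _ "int (card (lower_cell A \<omega> c)) - 1"]) (auto simp: simplex_def)
  qed
next
  fix F S assume S: "S \<in> ?T \<and> F face_of S"
  show "F \<in> ?T"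
  proof (cases "F = {}")
    case False
    then obtain c where "F face_of convex hull (lower_cell A \<omega> c)" using S by auto
    then obtain d where "F = convex hull (lower_cell A \<omega> d)"
      using lower_cell_face[OF assms(1) _ False] by blast
    then show ?thesis by blast
  qed simp
next
  fix S S' assume "S \<in> ?T \<and> S' \<in> ?T"
  then consider "S \<inter> S' = {}"
    | c d where "S = convex hull (lower_cell A \<omega> c)" "S' = convex hull (lower_cell A \<omega> d)" by auto
  then show "(S \<inter> S') face_of S"
  proof cases
    case 1 then show ?thesis by simp
  next
    case 2
    then show ?thesis
      using lower_cells_Int_hull[OF assms(1)] face_of_convex_hull_affine_independent[OF indep]
      by auto
  qed
qed

text \<open>This reduces the construction to a weight whose cells are affinely independent and
  generate the lattice points of their affine hulls; covering, gluing and regularity hold for lower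
  cells in general.\<close>

lemma has_regular_unimodular_triangulationI:
  fixes P :: "(real ^ 'n::finite) set"
  assumes fin: "finite (P \<inter> lattice_points)" and hull: "P = convex hull (P \<inter> lattice_points)"
    and int: "interior P \<noteq> {}"
    and indep: "\<And>c. \<not> affine_dependent (lower_cell (P \<inter> lattice_points) \<omega> c)"
    and unimod: "\<And>c x. x \<in> affine hull (lower_cell (P \<inter> lattice_points) \<omega> c) \<Longrightarrow> x \<in> lattice_points \<Longrightarrow>
       \<exists>u :: real ^ 'n \<Rightarrow> int. (\<Sum>v\<in>lower_cell (P \<inter> lattice_points) \<omega> c. u v) = 1 \<and>
          x = (\<Sum>v\<in>lower_cell (P \<inter> lattice_points) \<omega> c. of_int (u v) *\<^sub>R v)"
  shows "has_regular_unimodular_triangulation P"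
proof -
  define A where "A = P \<inter> lattice_points"
  define C where "C = lower_cell A \<omega>"
  define T where "T = insert {} (range (\<lambda>c. convex hull (C c)))"
  have "A \<noteq> {}" using hull int by (auto simp: A_def)
  have C_lat: "C c \<subseteq> lattice_points" and C_fin: "finite (C c)" for c
    using lower_cell_subset[of A \<omega> c] rev_finite_subset[OF fin[folded A_def] lower_cell_subset]
    by (auto simp: A_def C_def)
  have C_ne: "C c \<noteq> {}" for c
    using lower_cell_witness[OF fin[folded A_def] \<open>A \<noteq> {}\<close>] unfolding C_def by blast
  have "simplicial_complex T"
    unfolding T_def C_def
    by (rule lower_cells_simplicial_complex)
       (use fin indep in \<open>auto simp: A_def\<close>)
  moreover have "\<Union>T = P"
    using lower_cells_cover[OF fin, of \<omega>] hull int by (simp add: T_def C_def A_def)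
  moreover have "lattice_polytope S" if "S \<in> T" for S
    using that C_lat C_fin unfolding T_def lattice_polytope_def
    by (auto intro: exI[of _ "{}"])
  moreover have "T - {{}} = (\<lambda>F. fst ` F) ` lower_faces (lifted_polytope A \<omega>)"
  proof -
    let ?Q = "lifted_polytope A \<omega>"
    have "lower_faces ?Q = range (\<lambda>c. {z \<in> ?Q. \<forall>w\<in>?Q. (c, 1) \<bullet> z \<le> (c, 1) \<bullet> w})"
      unfolding lower_faces_def full_SetCompr_eq ..
    then have "(\<lambda>F. fst ` F) ` lower_faces ?Q = range (\<lambda>c. convex hull (C c))"
      unfolding C_def by (simp add: image_image fst_lower_face[OF fin[folded A_def] \<open>A \<noteq> {}\<close>])
    moreover have "{} \<notin> range (\<lambda>c. convex hull (C c))"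
      using C_ne convex_hull_eq_empty by blast
    ultimately show ?thesis by (simp add: T_def)
  qed
  moreover have "unimodular_simplex S" if "S \<in> T" for S
  proof -
    consider "S = {}" | c where "S = convex hull (C c)" using \<open>S \<in> T\<close> by (auto simp: T_def)
    then show ?thesis
    proof cases
      case 1
      \<comment> \<open>For the empty simplex the lattice condition is vacuous, its affine hull
        being empty.\<close>
      then show ?thesis
        unfolding unimodular_simplex_def by (intro exI[of _ "{}"]) auto
    next
      case 2
      then show ?thesis
        unfolding unimodular_simplex_def
        using C_lat[of c] indep[of c] unimod[of _ c]
        by (intro exI[of _ "C c"]) (auto simp: C_def A_def)
    qed
  qed
  ultimately show ?thesis
    unfolding has_regular_unimodular_triangulation_def regular_triangulation_of_def
      lattice_triangulation_of_def A_def by (intro exI[of _ T] conjI exI[of _ \<omega>] ballI)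
qed

section \<open>Unimodularity of independent vectors in an orthant\<close>

lemma finite_vec_components:
  assumes "finite F"
  shows "finite {v :: 'a ^ 'n::finite. \<forall>i. v $ i \<in> F}"
proof (rule finite_subset)
  show "{v :: 'a ^ 'n. \<forall>i. v $ i \<in> F} \<subseteq> vec_lambda ` (PiE UNIV (\<lambda>_. F))"
  proof
    fix v :: "'a ^ 'n" assume "v \<in> {v. \<forall>i. v $ i \<in> F}"
    then show "v \<in> vec_lambda ` (PiE UNIV (\<lambda>_. F))"
      by (intro image_eqI[of _ _ "vec_nth v"]) auto
  qed
  show "finite (vec_lambda ` (PiE UNIV (\<lambda>_. F)) :: ('a ^ 'n) set)"
    using assms by (intro finite_imageI finite_PiE) auto
qed

definition supp :: "real ^ 'n::finite \<Rightarrow> 'n set" where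
  "supp v = {i. v $ i \<noteq> 0}"

lemma supp_zero [simp]: "supp 0 = {}"
  by (simp add: supp_def)

lemma supp_eq_empty_iff [simp]: "supp v = {} \<longleftrightarrow> v = 0"
  by (auto simp: supp_def vec_eq_iff)

lemma vec_eq_sum_supp: "v = (\<Sum>i\<in>supp v. v $ i *\<^sub>R axis i 1)"
proof -
  have "(\<Sum>i\<in>supp v. v $ i *\<^sub>R axis i 1) $ k = v $ k" for k
  proof -
    have "(\<Sum>i\<in>supp v. v $ i *\<^sub>R axis i 1) $ k = (\<Sum>i\<in>supp v. if i = k then v $ k else 0)"
      unfolding sum_component by (intro sum.cong) (auto simp: axis_def)
    also have "\<dots> = v $ k" by (simp add: supp_def)
    finally show ?thesis .
  qed
  then show ?thesis by (simp add: vec_eq_iff)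
qed

text \<open>The two ends of an edge are distinct, so the two signed unit vectors can neither cancel
  nor add up to an entry of absolute value 2.\<close>

lemma B_set_eq:
  assumes "simple_graph E"
  shows "B_set E = {v. (\<forall>i. v $ i \<in> {-1, 0, 1}) \<and> (card (supp v) \<le> 1 \<or> supp v \<in> E)}"
    (is "_ = ?R")
proof (intro equalityI subsetI)
  fix v assume "v \<in> B_set E"
  then consider "v = 0" | s i where "v = s *\<^sub>R axis i 1" "s \<in> {1, -1}"
    | s t i j where "v = s *\<^sub>R axis i 1 + t *\<^sub>R axis j 1" "s \<in> {1, -1}" "t \<in> {1, -1}" "{i, j} \<in> E"
    unfolding B_set_def by blast
  then show "v \<in> ?R"
  proof cases
    case 1
    then show ?thesis by simp
  next
    case 2
    then have "supp v = {i}" by (auto simp: supp_def axis_def)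
    with 2 show ?thesis by (auto simp: axis_def)
  next
    case 3
    then have "i \<noteq> j" using assms by (auto simp: simple_graph_def)
    with 3 have "supp v = {i, j}" by (auto simp: supp_def axis_def)
    with 3 \<open>i \<noteq> j\<close> show ?thesis by (auto simp: axis_def)
  qed
next
  fix v assume v: "v \<in> ?R"
  then have sgn: "v $ i \<in> {1, -1}" if "i \<in> supp v" for i
    using that by (auto simp: supp_def)
  from v consider "supp v = {}" | "card (supp v) = 1" | "supp v \<in> E"
    by (auto simp: le_Suc_eq)
  then show "v \<in> B_set E"
  proof cases
    case 1
    then show ?thesis by (simp add: B_set_def)
  next
    case 2
    then obtain i where i: "supp v = {i}" by (auto simp: card_1_singleton_iff)
    then have "v = v $ i *\<^sub>R axis i 1" using vec_eq_sum_supp[of v] by simp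
    then show ?thesis unfolding B_set_def using sgn[of i] i by blast
  next
    case 3
    then have "card (supp v) = 2" using assms by (auto simp: simple_graph_def)
    then obtain i j where ij: "supp v = {i, j}" "i \<noteq> j" by (auto simp: card_2_iff)
    then have "v = v $ i *\<^sub>R axis i 1 + v $ j *\<^sub>R axis j 1" using vec_eq_sum_supp[of v] by simp
    moreover have "v $ i \<in> {1, -1}" "v $ j \<in> {1, -1}" "{i, j} \<in> E"
      using sgn[of i] sgn[of j] ij 3 by auto
    ultimately show ?thesis unfolding B_set_def by blast
  qed
qed

lemma B_set_component:
  assumes "simple_graph E" "v \<in> B_set E"
  shows "v $ i \<in> {-1, 0, 1}"
  using assms by (simp add: B_set_eq)

lemma abs_B_set_component:
  assumes "simple_graph E" "v \<in> B_set E" "v $ i \<noteq> 0"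
  shows "\<bar>v $ i\<bar> = 1"
  using B_set_component[OF assms(1,2), of i] assms(3) by auto

lemma card_supp_B_set:
  assumes "simple_graph E" "v \<in> B_set E"
  shows "card (supp v) \<le> 2"
  using assms by (auto simp: B_set_eq simple_graph_def)

lemma B_set_supp_edge:
  assumes "simple_graph E" "v \<in> B_set E" "card (supp v) = 2"
  shows "supp v \<in> E"
  using assms by (auto simp: B_set_eq)

lemma finite_B_set:
  assumes "simple_graph E"
  shows "finite (B_set E)"
  by (rule finite_subset[OF _ finite_vec_components[of "{-1, 0, 1}"]])
     (use B_set_component[OF assms] in auto)

lemma B_set_lattice:
  assumes "simple_graph E"
  shows "B_set E \<subseteq> lattice_points"
proof
  fix v assume "v \<in> B_set E"
  then have "v $ i \<in> \<int>" for i
    using B_set_component[OF assms, of v i] by auto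
  then show "v \<in> lattice_points" by (simp add: lattice_points_def)
qed

definition l1 :: "real ^ 'n::finite \<Rightarrow> real" where
  "l1 v = (\<Sum>i\<in>UNIV. \<bar>v $ i\<bar>)"

lemma l1_nonneg: "0 \<le> l1 v"
  by (simp add: l1_def sum_nonneg)

lemma l1_zero [simp]: "l1 0 = 0"
  by (simp add: l1_def)

text \<open>Supports have at most two elements, so a deletion leaves at most one. This supplies the
  exchange that forces a lower cell into a single orthant.\<close>

lemma B_set_delete_coordinate:
  fixes v :: "real ^ 'n::finite"
  assumes E: "simple_graph E" and v: "v \<in> B_set E" and i: "v $ i \<noteq> 0"
  defines "w \<equiv> v - v $ i *\<^sub>R axis i 1"
  shows "w \<in> B_set E" "l1 w = l1 v - 1"
proof -
  have w: "w $ k = (if k = i then 0 else v $ k)" for k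
    by (simp add: w_def axis_def)
  have "supp w = supp v - {i}" by (auto simp: supp_def w split: if_splits)
  moreover have "i \<in> supp v" using i by (simp add: supp_def)
  ultimately have "card (supp w) = card (supp v) - 1" by simp
  then have "card (supp w) \<le> 1" using card_supp_B_set[OF E v] by simp
  moreover have "\<forall>k. w $ k \<in> {-1, 0, 1}"
    using B_set_component[OF E v] by (auto simp: w)
  ultimately show "w \<in> B_set E" unfolding B_set_eq[OF E] by blast
  have "l1 v = \<bar>v $ i\<bar> + (\<Sum>k\<in>UNIV - {i}. \<bar>v $ k\<bar>)"
    unfolding l1_def by (rule sum.remove) auto
  moreover have "l1 w = \<bar>w $ i\<bar> + (\<Sum>k\<in>UNIV - {i}. \<bar>w $ k\<bar>)"
    unfolding l1_def by (rule sum.remove) auto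
  moreover have "(\<Sum>k\<in>UNIV - {i}. \<bar>w $ k\<bar>) = (\<Sum>k\<in>UNIV - {i}. \<bar>v $ k\<bar>)"
    by (intro sum.cong) (auto simp: w)
  ultimately show "l1 w = l1 v - 1"
    using abs_B_set_component[OF E v i] by (simp add: w)
qed

section \<open>Independent and dependent subsets of an orthant for a bipartite graph\<close>

locale bipartition =
  fixes E :: "'n::finite set set" and X :: "'n set"
  assumes edge: "e \<in> E \<Longrightarrow> \<exists>x\<in>X. \<exists>y\<in>-X. e = {x, y}"
begin

lemma simple: "simple_graph E"
  unfolding simple_graph_def
proof
  fix e assume "e \<in> E"
  then obtain x y where "x \<in> X" "y \<notin> X" "e = {x, y}" using edge by blast
  then show "card e = 2" by (auto simp: card_2_iff)
qed

text \<open>The equation places \<open>v\<close> in the closed orthant with sign vector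
  \<open>\<sigma>\<close>, zero entries being allowed. The origin is left out because these sets are
  tested for linear independence.\<close>

definition orthant_vectors :: "('n \<Rightarrow> real) \<Rightarrow> (real ^ 'n) set" where
  "orthant_vectors \<sigma> = {v \<in> B_set E - {0}. \<forall>i. \<sigma> i * v $ i = \<bar>v $ i\<bar>}"

lemma finite_orthant_subset: "C \<subseteq> orthant_vectors \<sigma> \<Longrightarrow> finite C"
  by (rule finite_subset[OF _ finite_B_set[OF simple]]) (auto simp: orthant_vectors_def)

text \<open>
  If every coordinate met by \<^term>\<open>C\<close> were met twice, then counting incidences shows that
  \<^term>\<open>C\<close> is a basis of its coordinate subspace consisting of edges only; but all edges lie
  in the kernel of the functional taking the \<^term>\<open>X\<close>-part minus the rest.
\<close>

lemma independent_has_leaf: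
  assumes C: "C \<subseteq> orthant_vectors \<sigma>" and ind: "independent C" and ne: "C \<noteq> {}"
    and \<sigma>: "\<And>i. \<bar>\<sigma> i\<bar> = 1"
  obtains i v where "v \<in> C" "v $ i \<noteq> 0" "\<And>w. w \<in> C - {v} \<Longrightarrow> w $ i = 0"
proof (rule ccontr)
  assume "\<not> thesis"
  with that have twice: "\<exists>w\<in>C - {v}. w $ i \<noteq> 0" if "v \<in> C" "v $ i \<noteq> 0" for v i
    using that by blast
  have fin: "finite C" using finite_orthant_subset[OF C] .
  have CB: "C \<subseteq> B_set E" using C by (auto simp: orthant_vectors_def)
  define S where "S = (\<Union>v\<in>C. supp v)"
  define V :: "(real ^ 'n) set" where "V = span ((\<lambda>i. axis i 1) ` S)"
  have "C \<subseteq> V"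
  proof
    fix v assume "v \<in> C"
    then have "(\<Sum>i\<in>supp v. v $ i *\<^sub>R axis i 1) \<in> V"
      unfolding V_def S_def by (intro span_sum span_mul span_base) auto
    then show "v \<in> V" using vec_eq_sum_supp[of v] by simp
  qed
  have dimV: "dim V \<le> card S"
  proof -
    have "dim V \<le> card ((\<lambda>i. axis i (1::real)) ` S)"
      unfolding V_def dim_span by (rule dim_le_card') simp
    also have "\<dots> \<le> card S" by (rule card_image_le) simp
    finally show ?thesis .
  qed
  have card_le: "card C \<le> card S"
    using independent_card_le_dim[OF \<open>C \<subseteq> V\<close> ind] dimV by simp
  \<comment> \<open>Double count of incidences: each coordinate in \<open>S\<close> is met at least
    twice and each vector meets at most two, while \<open>card C \<le> card S\<close>; hence
    equality holds throughout.\<close>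
  have "2 * card S = (\<Sum>i\<in>S. 2)" by simp
  also have "\<dots> \<le> (\<Sum>i\<in>S. card {v\<in>C. v $ i \<noteq> 0})"
  proof (rule sum_mono)
    fix i assume "i \<in> S"
    then obtain v where "v \<in> C" "v $ i \<noteq> 0" by (auto simp: S_def supp_def)
    moreover from twice[OF this] obtain w where "w \<in> C" "w \<noteq> v" "w $ i \<noteq> 0" by blast
    ultimately have "card {v, w} \<le> card {v\<in>C. v $ i \<noteq> 0}"
      using fin by (intro card_mono) auto
    then show "2 \<le> card {v\<in>C. v $ i \<noteq> 0}" using \<open>w \<noteq> v\<close> by simp
  qed
  also have "\<dots> = (\<Sum>i\<in>S. \<Sum>v\<in>C. if v $ i \<noteq> 0 then 1 else 0)"
    using fin by (simp add: sum.If_cases Collect_conj_eq Int_commute)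
  also have "\<dots> = (\<Sum>v\<in>C. \<Sum>i\<in>S. if v $ i \<noteq> 0 then 1 else 0)"
    by (rule sum.swap)
  also have "\<dots> = (\<Sum>v\<in>C. card (supp v))"
  proof (intro sum.cong refl)
    fix v assume "v \<in> C"
    then have "S \<inter> {i. v $ i \<noteq> 0} = supp v" by (auto simp: S_def supp_def)
    then show "(\<Sum>i\<in>S. if v $ i \<noteq> 0 then 1 else 0) = card (supp v)"
      by (simp add: sum.If_cases)
  qed
  finally have ge: "2 * card S \<le> (\<Sum>v\<in>C. card (supp v))" .
  have le2: "card (supp v) \<le> 2" if "v \<in> C" for v
    using card_supp_B_set[OF simple] CB that by blast
  then have le: "(\<Sum>v\<in>C. card (supp v)) \<le> 2 * card C"
    using sum_bounded_above[of C "\<lambda>v. card (supp v)" 2] by (simp add: mult.commute)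
  have "card (supp v) = 2" if "v \<in> C" for v
  proof (rule ccontr)
    assume "card (supp v) \<noteq> 2"
    then have "card (supp v) < 2" using le2[OF that] by simp
    then have "(\<Sum>v\<in>C. card (supp v)) < (\<Sum>v\<in>C. 2)"
      using fin that le2 by (intro sum_strict_mono_ex1) auto
    then show False using ge card_le by simp
  qed
  then have edges: "supp v \<in> E" if "v \<in> C" for v
    using B_set_supp_edge[OF simple] CB that by blast
  \<comment> \<open>An edge vector has one entry of absolute value 1 on each side of the
    bipartition, so \<open>h\<close> kills it; on a unit vector, however, \<open>h\<close> is
    \<open>1\<close> or \<open>-1\<close>.\<close>
  define h where "h x = (\<Sum>i\<in>UNIV. (if i \<in> X then \<sigma> i else - \<sigma> i) * x $ i)" for x :: "real ^ 'n"
  have "subspace {x. h x = 0}"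
    unfolding subspace_def h_def
    by (auto simp: algebra_simps sum.distrib simp flip: sum_distrib_left)
  moreover have "C \<subseteq> {x. h x = 0}"
  proof
    fix v assume v: "v \<in> C"
    then obtain x y where xy: "x \<in> X" "y \<notin> X" "supp v = {x, y}" using edge edges by blast
    have "h v = (\<Sum>i\<in>{x, y}. (if i \<in> X then \<sigma> i else - \<sigma> i) * v $ i)"
      unfolding h_def by (rule sum.mono_neutral_right) (use xy(3) in \<open>auto simp: supp_def\<close>)
    also have "\<dots> = \<sigma> x * v $ x - \<sigma> y * v $ y"
      using xy by (subst sum.insert) auto
    also have "\<dots> = \<bar>v $ x\<bar> - \<bar>v $ y\<bar>"
      using C v by (auto simp: orthant_vectors_def)
    also have "\<dots> = 0"
      using abs_B_set_component[OF simple, of v x] abs_B_set_component[OF simple, of v y] CB v xy(3)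
      by (auto simp: supp_def set_eq_iff)
    finally show "v \<in> {x. h x = 0}" by simp
  qed
  ultimately have "span C \<subseteq> {x. h x = 0}" by (rule span_minimal[rotated])
  \<comment> \<open>The double count gives \<open>card C\<close> at least \<open>dim V\<close>, so
    the independent set \<open>C\<close> spans \<open>V\<close>.\<close>
  moreover have "V \<subseteq> span C"
    by (rule card_ge_dim_independent[OF \<open>C \<subseteq> V\<close> ind]) (use dimV ge le in simp)
  moreover obtain i where "i \<in> S"
  proof -
    obtain v where "v \<in> C" "v \<noteq> 0" using ne C by (auto simp: orthant_vectors_def)
    then show thesis using that by (auto simp: S_def simp flip: supp_eq_empty_iff)
  qed
  then have "axis i 1 \<in> V" unfolding V_def by (intro span_base) auto
  ultimately have "h (axis i 1) = 0" by blast
  moreover have "h (axis i 1) = (if i \<in> X then \<sigma> i else - \<sigma> i)"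
  proof -
    have "h (axis i 1) = (\<Sum>k\<in>UNIV. if k = i then (if i \<in> X then \<sigma> i else - \<sigma> i) else 0)"
      unfolding h_def by (intro sum.cong) (auto simp: axis_def)
    then show ?thesis by simp
  qed
  ultimately show False using \<sigma>[of i] by (auto split: if_splits)
qed

text \<open>At the coordinate of a leaf only that vector contributes, with entry \<open>1\<close> or
  \<open>-1\<close>, so its coefficient is an integer. Subtracting its term leaves a lattice point
  combined from one vector fewer.\<close>

lemma independent_unimodular:
  assumes "C \<subseteq> orthant_vectors \<sigma>" "independent C" "\<And>i. \<bar>\<sigma> i\<bar> = 1"
    and "(\<Sum>v\<in>C. u v *\<^sub>R v) \<in> lattice_points" "v \<in> C"
  shows "u v \<in> \<int>"
  using assms(1,2,4,5)
proof (induction "card C" arbitrary: C v)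
  case 0
  then show ?case using finite_orthant_subset[OF 0(2)] by simp
next
  case (Suc n)
  have fin: "finite C" using finite_orthant_subset[OF Suc(3)] .
  have "C \<noteq> {}" using Suc.prems by auto
  obtain i l where l: "l \<in> C" "l $ i \<noteq> 0" "\<And>w. w \<in> C - {l} \<Longrightarrow> w $ i = 0"
    using independent_has_leaf[OF Suc.prems(1,2) _ assms(3)] \<open>C \<noteq> {}\<close> by metis
  have lB: "l \<in> B_set E" using l(1) Suc.prems(1) by (auto simp: orthant_vectors_def)
  have split: "(\<Sum>v\<in>C. u v *\<^sub>R v) = u l *\<^sub>R l + (\<Sum>v\<in>C - {l}. u v *\<^sub>R v)"
    by (rule sum.remove[OF fin l(1)])
  have "(\<Sum>v\<in>C - {l}. u v *\<^sub>R v) $ i = 0"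
    unfolding sum_component by (intro sum.neutral) (use l in auto)
  then have "u l * l $ i \<in> \<int>"
    using Suc.prems(3) arg_cong[OF split, of "\<lambda>x. x $ i"]
    by (auto simp: lattice_points_def dest: spec[of _ i])
  moreover have "l $ i = 1 \<or> l $ i = -1" using B_set_component[OF simple lB, of i] l by auto
  ultimately have ul: "u l \<in> \<int>" by auto
  show ?case
  proof (cases "v = l")
    case False
    have "(\<Sum>v\<in>C - {l}. u v *\<^sub>R v) = (\<Sum>v\<in>C. u v *\<^sub>R v) - u l *\<^sub>R l" using split by simp
    moreover have "l \<in> lattice_points" using lB B_set_lattice[OF simple] by blast
    ultimately have "(\<Sum>v\<in>C - {l}. u v *\<^sub>R v) \<in> lattice_points"
      using Suc.prems(3) ul unfolding lattice_points_def by simp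
    moreover have "n = card (C - {l})" using Suc(2) fin l by simp
    moreover have "independent (C - {l})" using independent_mono[OF Suc.prems(2)] by simp
    moreover have "C - {l} \<subseteq> orthant_vectors \<sigma>" "v \<in> C - {l}" using Suc.prems(1,4) False by auto
    ultimately show ?thesis using Suc.hyps(1) by simp
  qed (use ul in simp)
qed

text \<open>
  In a minimal relation the ratio of any two coefficients is an integer, so all coefficients
  agree up to sign.
\<close>

lemma dependent_balanced_relation:
  assumes C: "C \<subseteq> orthant_vectors \<sigma>" and dep: "dependent C" and \<sigma>: "\<And>i. \<bar>\<sigma> i\<bar> = 1"
  obtains L R where "L \<subseteq> C" "R \<subseteq> C" "L \<inter> R = {}" "L \<union> R \<noteq> {}" "\<Sum>L = \<Sum>R"
proof -
  \<comment> \<open>A dependent subset of least cardinality is a circuit: deleting any one vector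
    makes it independent, and every coefficient of its relation is nonzero.\<close>
  obtain D where D: "D \<subseteq> C" "dependent D" and
    least: "\<And>D'. D' \<subseteq> C \<Longrightarrow> dependent D' \<Longrightarrow> card D \<le> card D'"
    using ex_has_least_nat[of "\<lambda>D. D \<subseteq> C \<and> dependent D" C card] dep by blast
  have DO: "D \<subseteq> orthant_vectors \<sigma>" using D C by blast
  have fin: "finite D" using finite_orthant_subset[OF DO] .
  have ind: "independent (D - {d})" if "d \<in> D" for d
  proof
    assume "dependent (D - {d})"
    then have "card D \<le> card (D - {d})" using least[of "D - {d}"] D by blast
    then show False using fin that card_Diff1_less[OF fin that] by simp
  qed
  obtain u v0 where v0: "v0 \<in> D" "u v0 \<noteq> 0" and sum0: "(\<Sum>v\<in>D. u v *\<^sub>R v) = 0"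
    using D(2) dependent_finite[OF fin] by auto
  have nz: "u d \<noteq> 0" if "d \<in> D" for d
  proof
    assume "u d = 0"
    then have "(\<Sum>v\<in>D - {d}. u v *\<^sub>R v) = 0"
      using sum0 sum.remove[OF fin that, of "\<lambda>v. u v *\<^sub>R v"] by simp
    moreover have "v0 \<in> D - {d}" using v0 \<open>u d = 0\<close> by auto
    ultimately have "dependent (D - {d})"
      using dependent_finite[of "D - {d}"] fin v0 by blast
    then show False using ind[OF that] by simp
  qed
  \<comment> \<open>Solving the relation for \<open>d\<close> writes the lattice point
    \<open>- d\<close> in terms of the independent remaining vectors, to which unimodularity
    applies.\<close>
  have ratio: "u v / u d \<in> \<int>" if "v \<in> D" "d \<in> D" for v d
  proof (cases "v = d")
    case True
    then show ?thesis using nz that by simp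
  next
    case False
    have "u d *\<^sub>R d = - (\<Sum>v\<in>D - {d}. u v *\<^sub>R v)"
      using sum0 sum.remove[OF fin that(2), of "\<lambda>v. u v *\<^sub>R v"] by (simp add: eq_neg_iff_add_eq_0)
    then have "(- inverse (u d)) *\<^sub>R (u d *\<^sub>R d) = inverse (u d) *\<^sub>R (\<Sum>v\<in>D - {d}. u v *\<^sub>R v)"
      by simp
    then have "- d = (\<Sum>v\<in>D - {d}. (u v / u d) *\<^sub>R v)"
      using nz[OF that(2)] by (simp add: scaleR_sum_right divide_inverse mult.commute)
    moreover have "- d \<in> lattice_points"
      using DO that B_set_lattice[OF simple] by (auto simp: orthant_vectors_def lattice_points_def)
    ultimately have "(\<Sum>v\<in>D - {d}. (u v / u d) *\<^sub>R v) \<in> lattice_points" by simp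
    moreover have "D - {d} \<subseteq> orthant_vectors \<sigma>" using DO by blast
    ultimately show ?thesis
      using independent_unimodular[of "D - {d}" \<sigma> "\<lambda>v. u v / u d" v] ind[OF that(2)] \<sigma> that False
      by blast
  qed
  define k where "k = u v0"
  have pm: "u v = k \<or> u v = - k" if "v \<in> D" for v
  proof -
    \<comment> \<open>A ratio and its inverse are both nonzero integers, so both have absolute value
      1.\<close>
    have "1 \<le> \<bar>u v / k\<bar>" "1 \<le> \<bar>k / u v\<bar>"
      using ratio[OF that v0(1)] ratio[OF v0(1) that] nz[OF that] v0
      by (auto intro!: Ints_nonzero_abs_ge1 simp: k_def simp del: abs_divide)
    then have "\<bar>u v\<bar> = \<bar>k\<bar>"
      using nz[OF that] v0 by (auto simp: k_def field_simps)
    then show ?thesis by linarith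
  qed
  define L where "L = {v\<in>D. u v = k}"
  define R where "R = {v\<in>D. u v = - k}"
  have disj: "L \<inter> R = {}" using v0 by (auto simp: L_def R_def k_def)
  have un: "L \<union> R = D" using pm by (auto simp: L_def R_def)
  have "0 = (\<Sum>v\<in>L \<union> R. u v *\<^sub>R v)" using sum0 un by simp
  also have "\<dots> = (\<Sum>v\<in>L. u v *\<^sub>R v) + (\<Sum>v\<in>R. u v *\<^sub>R v)"
    by (rule sum.union_disjoint) (use fin disj in \<open>auto simp: L_def R_def\<close>)
  also have "\<dots> = (\<Sum>v\<in>L. k *\<^sub>R v) + (\<Sum>v\<in>R. - k *\<^sub>R v)"
    by (simp add: L_def R_def)
  also have "\<dots> = k *\<^sub>R (\<Sum>L - \<Sum>R)"
    by (simp add: scaleR_sum_right scaleR_diff_right sum_negf)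
  finally have "\<Sum>L = \<Sum>R" using v0 by (simp add: k_def)
  then show thesis
    using that[of L R] un D disj v0 by auto
qed

end

section \<open>Generic weights\<close>

text \<open>Powers of two with distinct exponents work: a subset sum is then the binary encoding of
  the subset.\<close>

lemma distinct_subset_sums:
  assumes "finite A"
  obtains \<delta> :: "'a \<Rightarrow> real" where "\<And>a. 0 < \<delta> a"
    "\<And>L R. L \<subseteq> A \<Longrightarrow> R \<subseteq> A \<Longrightarrow> sum \<delta> L = sum \<delta> R \<Longrightarrow> L = R"
proof -
  obtain f :: "'a \<Rightarrow> nat" where f: "inj_on f A"
    using finite_imp_inj_to_nat_seg[OF assms] by blast
  define \<delta> :: "'a \<Rightarrow> real" where "\<delta> a = 2 ^ f a" for a
  have enc: "sum \<delta> L = real (set_encode (f ` L))" if "L \<subseteq> A" for L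
    using inj_on_subset[OF f that] by (simp add: set_encode_def sum.reindex \<delta>_def)
  show thesis
  proof (rule that[of \<delta>])
    show "0 < \<delta> a" for a by (simp add: \<delta>_def)
    fix L R assume LR: "L \<subseteq> A" "R \<subseteq> A" "sum \<delta> L = sum \<delta> R"
    then have "set_encode (f ` L) = set_encode (f ` R)" using enc by simp
    then have "f ` L = f ` R"
      using finite_subset[OF LR(1) assms] finite_subset[OF LR(2) assms] by (simp add: set_encode_eq)
    then show "L = R" using inj_on_image_eq_iff[OF f] LR by blast
  qed
qed

text \<open>The growth clause makes deleting a coordinate lower the weight, which confines cells to
  one orthant. The last two clauses exclude a relation \<open>\<Sum>L = \<Sum>R\<close> inside a
  cell, split by whether the two sides have equally many vectors; within an orthant both sides have
  the same total \<open>l1\<close>.\<close>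

definition generic_weight :: "(real ^ 'n::finite) set \<Rightarrow> (real ^ 'n \<Rightarrow> real) \<Rightarrow> bool" where
  "generic_weight A \<omega> \<longleftrightarrow> \<omega> 0 = 0 \<and>
     (\<forall>p\<in>A. \<forall>v\<in>A. l1 p + 1 \<le> l1 v \<longrightarrow> \<omega> p < \<omega> v) \<and>
     (\<forall>L R. L \<subseteq> A - {0} \<longrightarrow> R \<subseteq> A - {0} \<longrightarrow> sum l1 L = sum l1 R \<longrightarrow>
        (card L = card R \<longrightarrow> sum \<omega> L = sum \<omega> R \<longrightarrow> L = R) \<and>
        (card R < card L \<longrightarrow> sum \<omega> R < sum \<omega> L))"

lemma generic_weight_exists:
  assumes "finite (A :: (real ^ 'n::finite) set)"
  obtains \<omega> where "generic_weight A \<omega>"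
proof -
  obtain \<delta> :: "real ^ 'n \<Rightarrow> real" where pos: "\<And>a. 0 < \<delta> a" and
    dist: "\<And>L R. L \<subseteq> A \<Longrightarrow> R \<subseteq> A \<Longrightarrow> sum \<delta> L = sum \<delta> R \<Longrightarrow> L = R"
    using distinct_subset_sums[OF assms] by blast
  \<comment> \<open>\<open>K\<close> exceeds the total perturbation of every subset, so the
    perturbation never outweighs a step of one unit in the dominant part.\<close>
  define K where "K = 1 + sum \<delta> A"
  have small: "sum \<delta> L < K" if "L \<subseteq> A" for L
    using sum_mono2[OF assms that, of \<delta>] pos by (force simp: K_def less_imp_le)
  have K: "0 < K" using small[of "{}"] by simp
  have \<delta>K: "\<delta> v < K" if "v \<in> A" for v using small[of "{v}"] that by simp
  \<comment> \<open>The summand 1 beside \<open>l1 v\<close> makes the weight of a set of nonzero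
    vectors record its cardinality.\<close>
  define \<omega> where "\<omega> v = (if v = 0 then 0 else K * (1 + l1 v) + \<delta> v)" for v :: "real ^ 'n"
  have sum\<omega>: "sum \<omega> L = K * (real (card L) + sum l1 L) + sum \<delta> L" if "L \<subseteq> A - {0}" for L
  proof -
    have "sum \<omega> L = (\<Sum>v\<in>L. K * (1 + l1 v) + \<delta> v)"
      using that by (intro sum.cong) (auto simp: \<omega>_def)
    then show ?thesis by (simp add: sum.distrib flip: sum_distrib_left)
  qed
  have "generic_weight A \<omega>"
    unfolding generic_weight_def
  proof (intro conjI ballI allI impI)
    show "\<omega> 0 = 0" by (simp add: \<omega>_def)
  next
    fix p v assume pv: "p \<in> A" "v \<in> A" "l1 p + 1 \<le> l1 v"
    then have "v \<noteq> 0" using l1_nonneg[of p] l1_zero by fastforce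
    have "\<omega> p \<le> K * (1 + l1 p) + \<delta> p"
      using K pos[of p] l1_nonneg[of p] by (auto simp: \<omega>_def)
    also have "\<dots> < K * (1 + l1 p) + K" using \<delta>K[OF pv(1)] by simp
    also have "\<dots> = K * (1 + (l1 p + 1))" by (simp add: algebra_simps)
    also have "\<dots> \<le> K * (1 + l1 v)" using pv K by (intro mult_left_mono) auto
    also have "\<dots> \<le> \<omega> v" using \<open>v \<noteq> 0\<close> pos[of v] by (simp add: \<omega>_def)
    finally show "\<omega> p < \<omega> v" .
  next
    fix L R assume LR: "L \<subseteq> A - {0}" "R \<subseteq> A - {0}" "sum l1 L = sum l1 R" "card L = card R"
      and "sum \<omega> L = sum \<omega> R"
    then have "sum \<delta> L = sum \<delta> R" using sum\<omega>[OF LR(1)] sum\<omega>[OF LR(2)] by simp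
    then show "L = R" using dist[of L R] LR by blast
  next
    fix L R assume LR: "L \<subseteq> A - {0}" "R \<subseteq> A - {0}" "sum l1 L = sum l1 R" "card R < card L"
    have "sum \<omega> R < K * (real (card R) + sum l1 R) + K"
      unfolding sum\<omega>[OF LR(2)] using small[of R] LR by auto
    also have "\<dots> = K * (real (card R + 1) + sum l1 R)" by (simp add: algebra_simps)
    also have "\<dots> \<le> K * (real (card L) + sum l1 L)"
      using LR K by (intro mult_left_mono) auto
    also have "\<dots> \<le> sum \<omega> L"
      unfolding sum\<omega>[OF LR(1)] using pos by (simp add: sum_nonneg less_imp_le)
    finally show "sum \<omega> R < sum \<omega> L" .
  qed
  then show thesis by (rule that)
qed

section \<open>The dual polytope and reflexivity\<close>

lemma dual_polytope_convex_hull: "dual_polytope (convex hull V) = {y. \<forall>v\<in>V. v \<bullet> y \<le> 1}"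
proof (intro equalityI subsetI)
  fix y assume "y \<in> dual_polytope (convex hull V)"
  then show "y \<in> {y. \<forall>v\<in>V. v \<bullet> y \<le> 1}"
    by (auto simp: dual_polytope_def hull_inc)
next
  fix y assume "y \<in> {y. \<forall>v\<in>V. v \<bullet> y \<le> 1}"
  then have "V \<subseteq> {x. y \<bullet> x \<le> 1}" by (auto simp: inner_commute)
  then have "convex hull V \<subseteq> {x. y \<bullet> x \<le> 1}"
    by (intro hull_minimal convex_halfspace_le)
  then show "y \<in> dual_polytope (convex hull V)"
    by (auto simp: dual_polytope_def inner_commute)
qed

lemma convex_dual_polytope: "convex (dual_polytope P)"
proof -
  have "dual_polytope P = (\<Inter>x\<in>P. {y. x \<bullet> y \<le> 1})" by (auto simp: dual_polytope_def)
  then show ?thesis by (simp add: convex_INT convex_halfspace_le)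
qed

lemma closed_dual_polytope: "closed (dual_polytope P)"
proof -
  have "dual_polytope P = (\<Inter>x\<in>P. {y. x \<bullet> y \<le> 1})" by (auto simp: dual_polytope_def)
  then show ?thesis by (simp add: closed_INT closed_halfspace_le)
qed

text \<open>Only the generators need testing, and the sign choices for each vertex or edge combine
  into one inequality between absolute values.\<close>

lemma dual_B_polytope:
  "dual_polytope (B_polytope E) =
     {y. (\<forall>i. \<bar>y $ i\<bar> \<le> 1) \<and> (\<forall>i j. {i, j} \<in> E \<longrightarrow> \<bar>y $ i\<bar> + \<bar>y $ j\<bar> \<le> 1)}" (is "_ = ?R")
proof -
  have "(\<forall>v\<in>B_set E. v \<bullet> y \<le> 1) \<longleftrightarrow> y \<in> ?R" for y
  proof
    assume y: "\<forall>v\<in>B_set E. v \<bullet> y \<le> 1"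
    have "s * y $ i \<le> 1" if "s \<in> {1, -1}" for s i
    proof -
      have "s *\<^sub>R axis i 1 \<in> B_set E" unfolding B_set_def using that by blast
      with y have "(s *\<^sub>R axis i 1) \<bullet> y \<le> 1" by blast
      then show ?thesis by (simp add: inner_axis')
    qed
    from this[of 1] this[of "-1"] have 1: "\<bar>y $ i\<bar> \<le> 1" for i
      by (simp add: abs_le_iff)
    have "s * y $ i + t * y $ j \<le> 1" if "s \<in> {1, -1}" "t \<in> {1, -1}" "{i, j} \<in> E" for s t i j
    proof -
      have "s *\<^sub>R axis i 1 + t *\<^sub>R axis j 1 \<in> B_set E" unfolding B_set_def using that by blast
      with y have "(s *\<^sub>R axis i 1 + t *\<^sub>R axis j 1) \<bullet> y \<le> 1" by blast
      then show ?thesis by (simp add: inner_add_left inner_axis')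
    qed
    from this[of 1 1] this[of 1 "-1"] this[of "-1" 1] this[of "-1" "-1"]
    have "\<bar>y $ i\<bar> + \<bar>y $ j\<bar> \<le> 1" if "{i, j} \<in> E" for i j
      using that by (simp add: abs_if)
    with 1 show "y \<in> ?R" by blast
  next
    assume y: "y \<in> ?R"
    show "\<forall>v\<in>B_set E. v \<bullet> y \<le> 1"
    proof
      fix v assume "v \<in> B_set E"
      then consider "v = 0" | s i where "v = s *\<^sub>R axis i 1" "s \<in> {1, -1}"
        | s t i j where "v = s *\<^sub>R axis i 1 + t *\<^sub>R axis j 1" "s \<in> {1, -1}" "t \<in> {1, -1}" "{i, j} \<in> E"
        unfolding B_set_def by blast
      then show "v \<bullet> y \<le> 1"
      proof cases
        case 2
        moreover have "\<bar>y $ i\<bar> \<le> 1" using y by blast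
        ultimately show ?thesis by (auto simp: inner_axis' abs_le_iff)
      next
        case 3
        then have "\<bar>y $ i\<bar> + \<bar>y $ j\<bar> \<le> 1" using y by blast
        with 3 show ?thesis by (auto simp: inner_add_left inner_axis')
      qed simp
    qed
  qed
  then show ?thesis unfolding B_polytope_def dual_polytope_convex_hull by auto
qed

text \<open>
  The point with all coordinates 1/2 lies in the dual and on every edge inequality, so any
  lattice point occurring in a convex representation of it is tight on all edges and therefore
  2-colours the graph.
\<close>

lemma lattice_dual_imp_bipartite:
  assumes "simple_graph E" "lattice_polytope (dual_polytope (B_polytope E))"
  shows "bipartite E"
proof -
  let ?Q = "dual_polytope (B_polytope E)"
  obtain V where V: "finite V" "V \<subseteq> lattice_points" "?Q = convex hull V"
    using assms(2) by (auto simp: lattice_polytope_def)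
  define h :: "real ^ 'a" where "h = (\<chi> i. 1 / 2)"
  have "h \<in> ?Q" by (simp add: dual_B_polytope h_def)
  then obtain u where u: "\<forall>v\<in>V. 0 \<le> u v" "sum u V = 1" "(\<Sum>v\<in>V. u v *\<^sub>R v) = h"
    unfolding V(3) convex_hull_finite[OF V(1)] by blast
  obtain w where w: "w \<in> V" "u w \<noteq> 0"
    using u(2) by (metis sum.neutral zero_neq_one)
  define X where "X = {i. w $ i = 1}"
  have "\<exists>x\<in>X. \<exists>y\<in>-X. e = {x, y}" if eE: "e \<in> E" for e
  proof -
    obtain i j where ij: "e = {i, j}"
      using assms(1) eE unfolding simple_graph_def card_2_iff by blast
    have edge: "\<bar>v $ i\<bar> + \<bar>v $ j\<bar> \<le> 1" if "v \<in> V" for v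
    proof -
      have "v \<in> ?Q" using that V(3) hull_inc by fastforce
      then show ?thesis using \<open>e \<in> E\<close> ij by (simp add: dual_B_polytope)
    qed
    \<comment> \<open>The edge inequality is negated because the tightness lemma is stated for lower
      bounds.\<close>
    have "(\<Sum>v\<in>V. u v * (- (v $ i + v $ j))) = - (h $ i + h $ j)"
      unfolding u(3)[symmetric] by (simp add: sum.distrib sum_negf sum_subtractf algebra_simps)
    then have le: "(\<Sum>v\<in>V. u v * (- (v $ i + v $ j))) \<le> - 1" by (simp add: h_def)
    have "- (w $ i + w $ j) = - 1"
    proof (rule convex_combination_tight[OF V(1) _ u(2) _ le w])
      show "- 1 \<le> - (v $ i + v $ j)" if "v \<in> V" for v
        using edge[OF that] by linarith
    qed (use u in auto)
    moreover have "\<bar>w $ i\<bar> + \<bar>w $ j\<bar> \<le> 1" using edge[OF w(1)] .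
    moreover have "w $ i \<in> \<int>" "w $ j \<in> \<int>"
      using w(1) V(2) by (auto simp: lattice_points_def)
    then obtain a b where "w $ i = of_int a" "w $ j = of_int b" by (metis Ints_cases)
    ultimately have "a + b = 1" "\<bar>a\<bar> + \<bar>b\<bar> \<le> 1" by linarith+
    then have "a = 1 \<and> b = 0 \<or> a = 0 \<and> b = 1" by presburger
    then have "(i \<in> X \<and> j \<notin> X) \<or> (j \<in> X \<and> i \<notin> X)"
      using \<open>w $ i = of_int a\<close> \<open>w $ j = of_int b\<close> by (auto simp: X_def)
    then show ?thesis using ij by blast
  qed
  then show ?thesis
    unfolding bipartite_def by (intro exI[of _ X] exI[of _ "-X"]) auto
qed

section \<open>Reduction of reflexivity to integrality of the dual\<close>

text \<open>A point \<open>x\<close> of norm below \<open>1 / n\<close> is the average of the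
  \<open>n\<close> points \<open>(n * x $ i) *\<^sub>R axis i 1\<close>, each on the segment between
  two opposite unit vectors. So a ball around the origin fits inside.\<close>

lemma zero_interior_B_polytope: "0 \<in> interior (B_polytope (E :: 'n::finite set set))"
proof -
  let ?P = "B_polytope E"
  have cx: "convex ?P" by (simp add: B_polytope_def)
  have unit: "t *\<^sub>R axis i 1 \<in> ?P" if t: "\<bar>t\<bar> \<le> 1" for t i
  proof -
    have "1 *\<^sub>R axis i 1 \<in> ?P" "(-1) *\<^sub>R axis i 1 \<in> ?P"
      unfolding B_polytope_def B_set_def by (intro hull_inc; blast)+
    then have "((1 + t) / 2) *\<^sub>R (1 *\<^sub>R axis i 1) + ((1 - t) / 2) *\<^sub>R ((-1) *\<^sub>R axis i 1) \<in> ?P"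
      using t by (intro convexD[OF cx]) (auto simp: field_simps)
    moreover have "((1 + t) / 2) *\<^sub>R (1 *\<^sub>R axis i 1) + ((1 - t) / 2) *\<^sub>R ((-1) *\<^sub>R axis i 1) =
        t *\<^sub>R (axis i 1 :: real ^ 'n)"
      by (simp add: scaleR_left_diff_distrib[symmetric] field_simps)
    ultimately show ?thesis by simp
  qed
  define n where "n = real CARD('n)"
  have "0 < n" by (simp add: n_def)
  have "ball 0 (1 / n) \<subseteq> ?P"
  proof
    fix x :: "real ^ 'n" assume "x \<in> ball 0 (1 / n)"
    then have "norm x < 1 / n" by simp
    then have "\<bar>x $ i\<bar> < 1 / n" for i using component_le_norm_cart[of x i] by linarith
    then have "\<bar>n * x $ i\<bar> \<le> 1" for i
      using \<open>0 < n\<close> by (simp add: abs_mult field_simps less_imp_le)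
    then have "(\<Sum>i\<in>UNIV. (1 / n) *\<^sub>R ((n * x $ i) *\<^sub>R axis i 1)) \<in> ?P"
      using \<open>0 < n\<close> by (intro convex_sum[OF _ cx] unit) (auto simp: n_def)
    moreover have "(\<Sum>i\<in>UNIV. (1 / n) *\<^sub>R ((n * x $ i) *\<^sub>R axis i 1)) = x"
      using \<open>0 < n\<close> basis_expansion[of x] by (simp add: scalar_mult_eq_scaleR)
    ultimately show "x \<in> ?P" by simp
  qed
  then show ?thesis using \<open>0 < n\<close> mem_interior by fastforce
qed

lemma B_polytope_subset_cube:
  assumes "simple_graph E"
  shows "B_polytope E \<subseteq> cbox (\<chi> i. -1) (\<chi> i. 1)"
  unfolding B_polytope_def
proof (intro hull_minimal convex_box)
  show "B_set E \<subseteq> cbox (\<chi> i. -1) (\<chi> i. 1)"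
  proof
    fix v assume "v \<in> B_set E"
    then have "- 1 \<le> v $ i \<and> v $ i \<le> 1" for i
      using B_set_component[OF assms, of v i] by auto
    then show "v \<in> cbox (\<chi> i. -1) (\<chi> i. 1)" by (simp add: mem_box_cart)
  qed
qed

text \<open>An interior origin gives full dimension, and the polytope lies in the cube with entries
  between -1 and 1, whose interior has the origin as its only lattice point. What is left of
  reflexivity is the condition on the dual.\<close>

lemma reflexive_B_polytope_iff:
  fixes E :: "'n::finite set set"
  assumes "simple_graph E"
  shows "reflexive (B_polytope E) \<longleftrightarrow> lattice_polytope (dual_polytope (B_polytope E))"
proof -
  let ?P = "B_polytope E"
  have "lattice_polytope ?P"
    unfolding lattice_polytope_def B_polytope_def
    using finite_B_set[OF assms] B_set_lattice[OF assms] by blast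
  moreover have "aff_dim ?P = int CARD('n)"
    using aff_dim_nonempty_interior[of ?P] zero_interior_B_polytope[of E] by auto
  moreover have "interior ?P \<inter> lattice_points = {0}"
  proof -
    have "x = 0" if x: "x \<in> interior ?P" "x \<in> lattice_points" for x
    proof -
      have "x \<in> box (\<chi> i. -1) (\<chi> i. 1)"
        using interior_mono[OF B_polytope_subset_cube[OF assms]] x(1) by (auto simp: interior_cbox)
      then have "\<bar>x $ i\<bar> < 1" for i by (simp add: mem_box_cart abs_less_iff minus_less_iff)
      moreover have "x $ i \<in> \<int>" for i using x(2) by (simp add: lattice_points_def)
      ultimately have "x $ i = 0" for i by (metis Ints_nonzero_abs_less1)
      then show ?thesis by (simp add: vec_eq_iff)
    qed
    moreover have "(0 :: real ^ 'n) \<in> lattice_points" by (simp add: lattice_points_def)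
    ultimately show ?thesis using zero_interior_B_polytope[of E] by blast
  qed
  ultimately show ?thesis by (simp add: reflexive_def)
qed

section \<open>Bipartite graphs: the dual is a lattice polytope, and the lattice points are
  B(G)\<close>

context bipartition
begin

text \<open>
  A point of the dual with a fractional coordinate is not extreme: moving all fractional
  coordinates away from 0 on \<^term>\<open>X\<close> and towards 0 off \<^term>\<open>X\<close>, or the other way round,
  stays inside.
\<close>

lemma dual_extreme_point_integral:
  assumes "y extreme_point_of dual_polytope (B_polytope E)"
  shows "y $ i \<in> {-1, 0, 1}"
proof (rule ccontr)
  assume "y $ i \<notin> {-1, 0, 1}"
  let ?Q = "dual_polytope (B_polytope E)"
  have yQ: "y \<in> ?Q" using assms by (simp add: extreme_point_of_def)
  have y1: "\<bar>y $ k\<bar> \<le> 1" for k using yQ by (simp add: dual_B_polytope)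
  have y2: "\<bar>y $ k\<bar> + \<bar>y $ l\<bar> \<le> 1" if "{k, l} \<in> E" for k l
    using yQ that by (simp add: dual_B_polytope)
  define F where "F = {k. y $ k \<notin> {-1, 0, 1}}"
  have F: "0 < \<bar>y $ k\<bar>" "\<bar>y $ k\<bar> < 1" if "k \<in> F" for k
    using that y1[of k] by (auto simp: F_def abs_if split: if_splits)
  have notF: "\<bar>y $ k\<bar> = 0 \<or> \<bar>y $ k\<bar> = 1" if "k \<notin> F" for k
    using that by (auto simp: F_def)
  have "i \<in> F" using \<open>y $ i \<notin> {-1, 0, 1}\<close> by (simp add: F_def)
  \<comment> \<open>With this step size no fractional coordinate crosses 0 or exceeds absolute value
    1.\<close>
  define \<epsilon> where "\<epsilon> = Min ((\<lambda>k. min \<bar>y $ k\<bar> (1 - \<bar>y $ k\<bar>)) ` F)"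
  have "0 < \<epsilon>"
    unfolding \<epsilon>_def using \<open>i \<in> F\<close> F by (subst Min_gr_iff) auto
  have \<epsilon>: "\<epsilon> \<le> \<bar>y $ k\<bar>" "\<epsilon> \<le> 1 - \<bar>y $ k\<bar>" if "k \<in> F" for k
  proof -
    have "\<epsilon> \<le> min \<bar>y $ k\<bar> (1 - \<bar>y $ k\<bar>)" unfolding \<epsilon>_def using that by (intro Min_le) auto
    then show "\<epsilon> \<le> \<bar>y $ k\<bar>" "\<epsilon> \<le> 1 - \<bar>y $ k\<bar>" by auto
  qed
  define d :: "real ^ 'n" where
    "d = (\<chi> k. if k \<in> F then (if k \<in> X then sgn (y $ k) else - sgn (y $ k)) else 0)"
  have stay: "y + (\<tau> * \<epsilon>) *\<^sub>R d \<in> ?Q" if \<tau>: "\<tau> = 1 \<or> \<tau> = -1" for \<tau> :: real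
  proof -
    define z where "z = y + (\<tau> * \<epsilon>) *\<^sub>R d"
    have zF: "\<bar>z $ k\<bar> = \<bar>y $ k\<bar> + (if k \<in> X then \<tau> * \<epsilon> else - (\<tau> * \<epsilon>))" if "k \<in> F" for k
      using \<tau> \<epsilon>[OF that] F[OF that] \<open>0 < \<epsilon>\<close> that
      by (cases "y $ k > 0") (auto simp: z_def d_def sgn_if abs_if)
    have znF: "z $ k = y $ k" if "k \<notin> F" for k using that by (simp add: z_def d_def)
    have z1: "\<bar>z $ k\<bar> \<le> 1" for k
    proof (cases "k \<in> F")
      case True
      then show ?thesis using zF[OF True] \<epsilon>[OF True] \<tau> \<open>0 < \<epsilon>\<close> by auto
    qed (use znF y1 in simp)
    have z2: "\<bar>z $ a\<bar> + \<bar>z $ b\<bar> \<le> 1" if "{a, b} \<in> E" "a \<in> X" "b \<notin> X" for a b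
    proof -
      have ab: "\<bar>y $ a\<bar> + \<bar>y $ b\<bar> \<le> 1" using y2 that by blast
      \<comment> \<open>If both ends are fractional, the gain at one cancels the loss at the other.
        An integral end opposite a fractional one must be 0, because its absolute value is 0 or 1
        and the edge inequality holds for \<open>y\<close>.\<close>
      consider "a \<in> F" "b \<in> F" | "a \<in> F" "b \<notin> F" | "a \<notin> F" "b \<in> F" | "a \<notin> F" "b \<notin> F" by blast
      then show ?thesis
      proof cases
        case 1
        then show ?thesis using zF[of a] zF[of b] that ab by simp
      next
        case 2
        then have "\<bar>y $ b\<bar> = 0" using notF[of b] F[of a] ab by linarith
        then show ?thesis using z1[of a] znF[of b] 2 by simp
      next
        case 3
        then have "\<bar>y $ a\<bar> = 0" using notF[of a] F[of b] ab by linarith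
        then show ?thesis using z1[of b] znF[of a] 3 by simp
      next
        case 4
        then show ?thesis using znF ab by simp
      qed
    qed
    have "\<bar>z $ k\<bar> + \<bar>z $ l\<bar> \<le> 1" if kl: "{k, l} \<in> E" for k l
    proof -
      obtain a b where "a \<in> X" "b \<notin> X" "{k, l} = {a, b}" using edge[OF kl] by blast
      then show ?thesis using z2[of a b] kl by (auto simp: doubleton_eq_iff insert_commute add.commute)
    qed
    with z1 show ?thesis by (simp add: dual_B_polytope z_def)
  qed
  let ?a = "y + (1 * \<epsilon>) *\<^sub>R d" and ?b = "y + (-1 * \<epsilon>) *\<^sub>R d"
  have "d $ i \<noteq> 0" using \<open>i \<in> F\<close> F[OF \<open>i \<in> F\<close>] by (auto simp: d_def sgn_if)
  then have "?a $ i \<noteq> ?b $ i" using \<open>0 < \<epsilon>\<close> by simp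
  then have "?a \<noteq> ?b" by metis
  moreover have "midpoint ?a ?b = y" by (simp add: midpoint_def algebra_simps flip: scaleR_2)
  ultimately have "y \<in> open_segment ?a ?b" using midpoint_in_open_segment[of ?a ?b] by metis
  then show False using assms stay[of 1] stay[of "-1"] by (auto simp: extreme_point_of_def)
qed

text \<open>By Krein-Milman the compact dual is the hull of its extreme points; these have entries
  in \<open>{-1, 0, 1}\<close>, so they are finitely many lattice points.\<close>

lemma lattice_polytope_dual: "lattice_polytope (dual_polytope (B_polytope E))"
proof -
  let ?Q = "dual_polytope (B_polytope E)" and ?V = "{y. y extreme_point_of dual_polytope (B_polytope E)}"
  have "?Q \<subseteq> cbox (\<chi> i. -1) (\<chi> i. 1)"
    by (auto simp: dual_B_polytope mem_box_cart abs_le_iff minus_le_iff)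
  then have "compact ?Q"
    using closed_dual_polytope bounded_cbox bounded_subset compact_eq_bounded_closed by blast
  then have "?Q = convex hull ?V" by (rule Krein_Milman_Minkowski[OF _ convex_dual_polytope])
  moreover have V: "?V \<subseteq> {y. \<forall>i. y $ i \<in> {-1, 0, 1}}" using dual_extreme_point_integral by blast
  then have "finite ?V" by (rule finite_subset) (simp add: finite_vec_components del: insert_iff)
  moreover have "?V \<subseteq> lattice_points"
  proof
    fix y assume "y \<in> ?V"
    then have "y $ i \<in> {-1, 0, 1}" for i using V by blast
    then have "y $ i \<in> \<int>" for i by (metis Ints_0 Ints_1 Ints_minus insertE singletonD)
    then show "y \<in> lattice_points" by (simp add: lattice_points_def)
  qed
  ultimately show ?thesis unfolding lattice_polytope_def by blast
qed

text \<open>Points of the dual show that any two coordinates in the support of a lattice point are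
  adjacent. A support of three or more would then contain a triangle, which a bipartite graph
  lacks.\<close>

lemma B_polytope_lattice_points: "B_polytope E \<inter> lattice_points = B_set E"
proof (intro equalityI subsetI)
  fix x assume "x \<in> B_set E"
  then show "x \<in> B_polytope E \<inter> lattice_points"
    using B_set_lattice[OF simple] by (auto simp: B_polytope_def hull_inc)
next
  fix x assume x: "x \<in> B_polytope E \<inter> lattice_points"
  have x1: "x $ i \<in> {-1, 0, 1}" for i
  proof -
    have "\<bar>x $ i\<bar> \<le> 1"
      using x B_polytope_subset_cube[OF simple] by (auto simp: mem_box_cart abs_le_iff minus_le_iff)
    moreover have "x $ i \<in> \<int>" using x by (simp add: lattice_points_def)
    then obtain a where a: "x $ i = of_int a" by (rule Ints_cases)
    ultimately have "\<bar>a\<bar> \<le> 1" by linarith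
    then have "a = -1 \<or> a = 0 \<or> a = 1" by presburger
    then show ?thesis using a by auto
  qed
  have adj: "{i, j} \<in> E" if ij: "i \<in> supp x" "j \<in> supp x" "i \<noteq> j" for i j
  proof (rule ccontr)
    assume nE: "{i, j} \<notin> E"
    \<comment> \<open>Copying the entries of \<open>x\<close> at the nonadjacent pair gives a point
      of the dual whose inner product with \<open>x\<close> is 2.\<close>
    define y :: "real ^ 'n" where "y = (\<chi> k. if k = i \<or> k = j then x $ k else 0)"
    have "\<bar>y $ k\<bar> + \<bar>y $ l\<bar> \<le> 1" if kl: "{k, l} \<in> E" for k l
    proof -
      have "k \<noteq> l" using simple kl by (auto simp: simple_graph_def)
      moreover have "{k, l} \<noteq> {i, j}" using kl nE by metis
      ultimately have "y $ k = 0 \<or> y $ l = 0" by (auto simp: y_def)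
      then show ?thesis using x1[of k] x1[of l] by (auto simp: y_def)
    qed
    moreover have "\<bar>y $ k\<bar> \<le> 1" for k using x1[of k] by (auto simp: y_def)
    ultimately have "y \<in> dual_polytope (B_polytope E)" by (simp add: dual_B_polytope)
    then have "x \<bullet> y \<le> 1" using x by (auto simp: dual_polytope_def)
    moreover have "x \<bullet> y = (\<Sum>k\<in>{i, j}. x $ k * x $ k)"
      unfolding inner_vec_def by (rule sum.mono_neutral_cong_right) (auto simp: y_def)
    moreover have "x $ k * x $ k = 1" if "k \<in> supp x" for k
      using x1[of k] that by (auto simp: supp_def)
    ultimately show False using ij by simp
  qed
  have "card (supp x) \<le> 1 \<or> supp x \<in> E"
  proof (cases "card (supp x) \<le> 1")
    case False
    then obtain i j where ij: "i \<in> supp x" "j \<in> supp x" "i \<noteq> j"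
      by (metis card_le_Suc0_iff_eq finite One_nat_def)
    have "k \<in> {i, j}" if k: "k \<in> supp x" for k
    proof (rule ccontr)
      assume "k \<notin> {i, j}"
      then have "{i, j} \<in> E" "{i, k} \<in> E" "{j, k} \<in> E" using adj ij k by auto
      then have "(i \<in> X \<longleftrightarrow> j \<notin> X)" "(i \<in> X \<longleftrightarrow> k \<notin> X)" "(j \<in> X \<longleftrightarrow> k \<notin> X)"
        by (auto dest!: edge simp: doubleton_eq_iff)
      then show False by blast
    qed
    then have "supp x = {i, j}" using ij by blast
    then show ?thesis using adj ij by simp
  qed simp
  then show "x \<in> B_set E" using x1 by (simp add: B_set_eq[OF simple])
qed

end

section \<open>The triangulation\<close>

text \<open>Linear independence kills the coefficients off the origin; the coefficient at the origin
  then vanishes because all of them sum to 0.\<close>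

lemma affine_independent_if_independent_minus_zero:
  fixes S :: "'a::real_vector set"
  assumes "finite S" "independent (S - {0})"
  shows "\<not> affine_dependent S"
proof
  assume "affine_dependent S"
  then obtain U v where U: "sum U S = 0" "v \<in> S" "U v \<noteq> 0" "(\<Sum>v\<in>S. U v *\<^sub>R v) = 0"
    unfolding affine_dependent_explicit_finite[OF assms(1)] by blast
  have "(\<Sum>v\<in>S - {0}. U v *\<^sub>R v) = 0"
    using U(4) sum.mono_neutral_right[of S "S - {0}" "\<lambda>v. U v *\<^sub>R v"] assms(1) by auto
  then have zero: "U w = 0" if "w \<in> S - {0}" for w
    using that assms dependent_finite[of "S - {0}"] by auto
  then have "v = 0" using U by blast
  then have "sum U S = U 0 + sum U (S - {0})" using U(2) assms(1) by (simp add: sum.remove)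
  then show False using U \<open>v = 0\<close> zero by simp
qed

text \<open>On a single orthant \<open>l1\<close> is linear, so the total depends only on the vector
  sum; balanced sets therefore have equal totals.\<close>

lemma sum_l1_orthant:
  assumes "\<And>v i. v \<in> L \<Longrightarrow> \<sigma> i * v $ i = \<bar>v $ i\<bar>"
  shows "sum l1 L = (\<Sum>i\<in>UNIV. \<sigma> i * (\<Sum>L) $ i)"
proof -
  have "sum l1 L = (\<Sum>v\<in>L. \<Sum>i\<in>UNIV. \<sigma> i * v $ i)"
    unfolding l1_def using assms by (intro sum.cong) auto
  also have "\<dots> = (\<Sum>i\<in>UNIV. \<Sum>v\<in>L. \<sigma> i * v $ i)" by (rule sum.swap)
  finally show ?thesis by (simp add: sum_distrib_left)
qed

section \<open>Cells of a generic weight are unimodular simplices\<close>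

context bipartition
begin

text \<open>Opposite signs at a coordinate would allow a cheaper pair with the same sum, so the cell
  lies in one orthant. There a dependence yields a balanced relation, which contradicts the
  genericity of the weight.\<close>

lemma generic_lower_cell:
  assumes \<omega>: "generic_weight (B_set E) \<omega>"
  obtains \<sigma> where "\<And>i. \<bar>\<sigma> i\<bar> = 1" "lower_cell (B_set E) \<omega> c - {0} \<subseteq> orthant_vectors \<sigma>"
    "independent (lower_cell (B_set E) \<omega> c - {0})"
proof -
  let ?A = "B_set E"
  define C where "C = lower_cell ?A \<omega> c - {0}"
  have CA: "C \<subseteq> ?A - {0}" using lower_cell_subset[of ?A \<omega> c] by (auto simp: C_def)
  have "\<not> v $ i * w $ i < 0" if vw: "v \<in> C" "w \<in> C" for v w i
  proof
    assume neg: "v $ i * w $ i < 0"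
    have B: "v \<in> ?A" "w \<in> ?A" using vw CA by auto
    have nz: "v $ i \<noteq> 0" "w $ i \<noteq> 0" using neg by auto
    have opp: "w $ i = - v $ i"
      using neg B_set_component[OF simple B(1), of i] B_set_component[OF simple B(2), of i] by auto
    \<comment> \<open>Deleting the two opposite entries preserves the vector sum, hence the
      \<open>c\<close>-part, but lowers both weights, against the minimality of the cell.\<close>
    define p where "p = v - v $ i *\<^sub>R axis i 1"
    define q where "q = w - w $ i *\<^sub>R axis i 1"
    have pq: "p + q = v + w" unfolding p_def q_def opp by simp
    have pA: "p \<in> ?A" "l1 p = l1 v - 1"
      using B_set_delete_coordinate[OF simple B(1) nz(1)] by (auto simp: p_def)
    have qA: "q \<in> ?A" "l1 q = l1 w - 1"
      using B_set_delete_coordinate[OF simple B(2) nz(2)] by (auto simp: q_def)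
    have "\<omega> p < \<omega> v" "\<omega> q < \<omega> w" using \<omega> pA qA B by (auto simp: generic_weight_def)
    moreover have "c \<bullet> v + \<omega> v \<le> c \<bullet> p + \<omega> p" "c \<bullet> w + \<omega> w \<le> c \<bullet> q + \<omega> q"
      using vw pA qA by (auto simp: C_def intro: lower_cell_le)
    moreover have "c \<bullet> p + c \<bullet> q = c \<bullet> v + c \<bullet> w" using pq by (metis inner_add_right)
    ultimately show False by linarith
  qed
  note compat = this
  \<comment> \<open>By compatibility a coordinate with a negative entry has no positive one; all
    other coordinates, including those that vanish on the cell, get sign 1 by default.\<close>
  define \<sigma> :: "'n \<Rightarrow> real" where "\<sigma> i = (if \<exists>v\<in>C. v $ i < 0 then -1 else 1)" for i
  have \<sigma>1: "\<bar>\<sigma> i\<bar> = 1" for i by (simp add: \<sigma>_def)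
  have \<sigma>: "\<sigma> i * v $ i = \<bar>v $ i\<bar>" if v: "v \<in> C" for v i
  proof (cases "\<exists>w\<in>C. w $ i < 0")
    case True
    then obtain w where w: "w \<in> C" "w $ i < 0" by blast
    then have "v $ i \<le> 0" using compat[OF v w(1), of i] by (auto simp: mult_less_0_iff)
    then show ?thesis using True by (simp add: \<sigma>_def)
  next
    case False
    then show ?thesis using v by (force simp: \<sigma>_def)
  qed
  have CO: "C \<subseteq> orthant_vectors \<sigma>" using CA \<sigma> by (auto simp: orthant_vectors_def)
  have "independent C"
  proof
    assume "dependent C"
    then obtain L R where LR: "L \<subseteq> C" "R \<subseteq> C" "L \<inter> R = {}" "L \<union> R \<noteq> {}" "\<Sum>L = \<Sum>R"
      using dependent_balanced_relation[OF CO _ \<sigma>1] by metis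
    then have "L \<noteq> R" by auto
    have l1: "sum l1 L = sum l1 R"
      using sum_l1_orthant[of L \<sigma>] sum_l1_orthant[of R \<sigma>] \<sigma> LR by (simp add: subset_iff)
    obtain a where a: "a \<in> L \<union> R" using LR by blast
    define m where "m = c \<bullet> a + \<omega> a"
    have aC: "a \<in> lower_cell ?A \<omega> c" using a LR by (auto simp: C_def)
    \<comment> \<open>The origin competes with value 0, so the minimum \<open>m\<close> is at most
      0.\<close>
    have "0 \<in> ?A" by (simp add: B_set_def)
    then have "m \<le> 0" using lower_cell_le[OF aC, of 0] \<omega> by (simp add: m_def generic_weight_def)
    have val: "c \<bullet> \<Sum>S + sum \<omega> S = real (card S) * m" if "S \<subseteq> C" for S
    proof -
      have "c \<bullet> \<Sum>S + sum \<omega> S = (\<Sum>v\<in>S. c \<bullet> v + \<omega> v)" by (simp add: inner_sum_right sum.distrib)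
      also have "\<dots> = (\<Sum>v\<in>S. m)"
        using that lower_cell_eq[OF aC] by (intro sum.cong) (auto simp: C_def m_def)
      finally show ?thesis by simp
    qed
    \<comment> \<open>The inner products with \<open>c\<close> cancel because both sides have the
      same vector sum.\<close>
    have eq: "sum \<omega> L - sum \<omega> R = (real (card L) - real (card R)) * m"
      using val[OF LR(1)] val[OF LR(2)] LR(5) by (simp add: algebra_simps)
    have sub: "L \<subseteq> ?A - {0}" "R \<subseteq> ?A - {0}" using LR CA by auto
    have dist: "L = R" if "card L = card R" "sum \<omega> L = sum \<omega> R"
      using \<omega> sub l1 that unfolding generic_weight_def by blast
    have less: "sum \<omega> S' < sum \<omega> S" if "S \<subseteq> ?A - {0}" "S' \<subseteq> ?A - {0}" "sum l1 S = sum l1 S'"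
      "card S' < card S" for S S'
      using \<omega> that unfolding generic_weight_def by blast
    consider "card L = card R" | "card R < card L" | "card L < card R" by linarith
    then show False
    proof cases
      case 1
      then show False using dist \<open>L \<noteq> R\<close> eq by simp
    next
      case 2
      \<comment> \<open>Genericity makes the larger set strictly heavier, while \<open>eq\<close>
        and \<open>m \<le> 0\<close> make it no heavier. The remaining case is symmetric.\<close>
      then have "sum \<omega> R < sum \<omega> L" using less[OF sub l1] by simp
      moreover have "(real (card L) - real (card R)) * m \<le> 0"
        using 2 \<open>m \<le> 0\<close> by (intro mult_nonneg_nonpos) auto
      ultimately show False using eq by linarith
    next
      case 3
      then have "sum \<omega> L < sum \<omega> R" using less[OF sub(2,1)] l1 by simp
      moreover have "0 \<le> (real (card L) - real (card R)) * m"
        using 3 \<open>m \<le> 0\<close> by (intro mult_nonpos_nonpos) auto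
      ultimately show False using eq by linarith
    qed
  qed
  then show thesis using that[OF \<sigma>1] CO by (simp add: C_def)
qed

text \<open>Unimodularity makes the coefficients off the origin integers. If the origin belongs to
  \<open>S\<close>, its coefficient is 1 minus their sum and so is an integer as well.\<close>

lemma orthant_affine_unimodular:
  assumes "finite S" "S - {0} \<subseteq> orthant_vectors \<sigma>" "independent (S - {0})" "\<And>i. \<bar>\<sigma> i\<bar> = 1"
    and x: "x \<in> affine hull S" "x \<in> lattice_points"
  shows "\<exists>u :: real ^ 'n \<Rightarrow> int. (\<Sum>v\<in>S. u v) = 1 \<and> x = (\<Sum>v\<in>S. of_int (u v) *\<^sub>R v)"
proof -
  obtain u where u: "sum u S = 1" "(\<Sum>v\<in>S. u v *\<^sub>R v) = x"
    using x(1) unfolding affine_hull_finite[OF assms(1)] by blast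
  have "(\<Sum>v\<in>S - {0}. u v *\<^sub>R v) = x"
    using u(2) sum.mono_neutral_right[of S "S - {0}" "\<lambda>v. u v *\<^sub>R v"] assms(1) by auto
  then have int: "u v \<in> \<int>" if "v \<in> S - {0}" for v
    using independent_unimodular[OF assms(2,3,4)] x(2) that by simp
  have "u v \<in> \<int>" if "v \<in> S" for v
  proof (cases "v = 0")
    case True
    then have "u v = 1 - sum u (S - {0})"
      using u(1) that assms(1) by (simp add: sum.remove)
    then show ?thesis using int by auto
  qed (use int that in auto)
  \<comment> \<open>The floor turns the integral real coefficients into coefficients of type
    \<open>int\<close> without changing their values.\<close>
  then have fl: "of_int \<lfloor>u v\<rfloor> = u v" if "v \<in> S" for v using that by simp
  have "of_int (\<Sum>v\<in>S. \<lfloor>u v\<rfloor>) = (1::real)"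
    unfolding u(1)[symmetric] of_int_sum by (rule sum.cong[OF refl fl])
  then have "(\<Sum>v\<in>S. \<lfloor>u v\<rfloor>) = 1" by linarith
  moreover have "x = (\<Sum>v\<in>S. of_int \<lfloor>u v\<rfloor> *\<^sub>R v)"
    unfolding u(2)[symmetric] by (rule sum.cong[OF refl]) (simp only: fl)
  ultimately show ?thesis by blast
qed

lemma regular_unimodular_triangulation: "has_regular_unimodular_triangulation (B_polytope E)"
proof -
  obtain \<omega> where \<omega>: "generic_weight (B_set E) \<omega>"
    using generic_weight_exists[OF finite_B_set[OF simple]] .
  have fin: "finite (lower_cell (B_set E) \<omega> c)" for c
    by (rule rev_finite_subset[OF finite_B_set[OF simple] lower_cell_subset])
  show ?thesis
  proof (rule has_regular_unimodular_triangulationI[where \<omega> = \<omega>], unfold B_polytope_lattice_points)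
    show "finite (B_set E)" using finite_B_set[OF simple] .
    show "B_polytope E = convex hull B_set E" by (simp add: B_polytope_def)
    show "interior (B_polytope E) \<noteq> {}" using zero_interior_B_polytope by blast
  next
    fix c
    have "independent (lower_cell (B_set E) \<omega> c - {0})"
      by (rule generic_lower_cell[OF \<omega>, of c])
    then show "\<not> affine_dependent (lower_cell (B_set E) \<omega> c)"
      by (rule affine_independent_if_independent_minus_zero[OF fin])
  next
    fix c x assume x: "x \<in> affine hull lower_cell (B_set E) \<omega> c" "x \<in> lattice_points"
    obtain \<sigma> where \<sigma>: "\<And>i. \<bar>\<sigma> i\<bar> = 1" "lower_cell (B_set E) \<omega> c - {0} \<subseteq> orthant_vectors \<sigma>"
      "independent (lower_cell (B_set E) \<omega> c - {0})"
      using generic_lower_cell[OF \<omega>, of c] by metis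
    show "\<exists>u :: real ^ 'n \<Rightarrow> int. (\<Sum>v\<in>lower_cell (B_set E) \<omega> c. u v) = 1 \<and>
        x = (\<Sum>v\<in>lower_cell (B_set E) \<omega> c. of_int (u v) *\<^sub>R v)"
      by (rule orthant_affine_unimodular[OF fin \<sigma>(2,3,1) x])
  qed
qed

end

lemma bipartite_imp_bipartition:
  assumes "bipartite E"
  obtains X where "bipartition E X"
proof -
  obtain X Y where "X \<inter> Y = {}" "\<forall>e\<in>E. \<exists>x\<in>X. \<exists>y\<in>Y. e = {x, y}"
    using assms unfolding bipartite_def by blast
  then have "\<exists>x\<in>X. \<exists>y\<in>-X. e = {x, y}" if "e \<in> E" for e
    using that by (metis ComplI disjoint_iff)
  then show thesis by (intro that[of X]) (simp add: bipartition_def)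
qed

theorem theorem0p1:
  fixes E :: "'n::finite set set"
  assumes "simple_graph E"
  shows "(reflexive (B_polytope E) \<and> has_regular_unimodular_triangulation (B_polytope E)
            \<longleftrightarrow> reflexive (B_polytope E))
       \<and> (reflexive (B_polytope E) \<longleftrightarrow> bipartite E)"
proof -
  have "bipartite E" if "reflexive (B_polytope E)"
    using lattice_dual_imp_bipartite[OF assms] reflexive_B_polytope_iff[OF assms] that by blast
  moreover have "reflexive (B_polytope E) \<and> has_regular_unimodular_triangulation (B_polytope E)"
    if bip: "bipartite E"
  proof -
    obtain X where "bipartition E X" using bipartite_imp_bipartition[OF bip] .
    then show ?thesis
      using bipartition.lattice_polytope_dual bipartition.regular_unimodular_triangulation
        reflexive_B_polytope_iff[OF assms] by blast
  qed
  ultimately show ?thesis by blast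
qed

end
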